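(* Let $m\ge 2$ and let $\Gamma=(v_1,\dots,v_m)$ be an odd shifting path with voltage assignment $\sigma$ into $\mathbb{Z}_n$ and endpoint voltage $r$ coprime to $n$. Let $l\in\mathbb{Z}_n$ and let $\mathcal P=\{P_0,\dots,P_{d-1}\}$ be the family of paths produced by the extended billiard strategy with $d=2\mathrm{c}(\Gamma)$, step $r$ and starting value $l$. Then $\Gamma^\sigma$ contains a Hamiltonian cycle $C$ and two edge subsets $E^L\subseteq E(v_1^\sigma)$, $E^R\subseteq E(v_m^\sigma)$ such that: $C$ contains all edges of $P_0,\dots,P_{d-1}$; $|E^L|=|E^R|=d/2$; $E^L=\{[(v_1,l),(v_1,l+r)],[(v_1,l+2r),(v_1,l+3r)],\dots,[(v_1,l+(d-2)r),(v_1,l+(d-1)r)]\}$; $E^L$ and $E^R$ are alternating consecutive edge sets; and $C$ contains all edges of $v_1^\sigma$ except those of $E^L$ and all edges of $v_m^\sigma$ except those of $E^R$.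
   Context: Voltage graphs and lifts: for a graph $\Gamma$ (loops allowed), each edge $[u,v]$ gives two arcs $(u,v),(v,u)$; a loop gives two arcs $(v,v)$, one primary and one secondary. A voltage assignment is a map $\sigma$ from the arcs to $\mathbb{Z}_n$ with $\sigma(v,u)=-\sigma(u,v)$ and the two loop arcs receiving opposite values; $\sigma(v)$ is the value on the primary loop at $v$. The lift $\Gamma^\sigma$ has vertex set $V(\Gamma)\times\mathbb{Z}_n$, with $(u,a)\sim(v,b)$ iff some arc $(u,v)$ has $\sigma(u,v)=b-a$. The fiber $v^\sigma$ is the subgraph induced by $\{(v,g)\}$. A reflexive graph has exactly one loop at each vertex. For a vertex $v$ whose loop has nonzero voltage, an edge set $E\subseteq E(v^\sigma)$ is an alternating consecutive edge set if $E$ is a color class of a proper 2-edge-coloring of some path contained in $v^\sigma$. $\mathrm{c}(\Gamma)$ for a reflexive path $\Gamma=(v_1,\dots,v_m)$: equals $1$ if $m=2$, and $\lceil\frac12\max\{\gcd(n,\sigma(v_t)):2\le t\le m-1\}\rceil$ if $m\ge3$ (with $\gcd(n,0)=n$). Extended billiard strategy (parameters $r,l\in\mathbb{Z}_n$, integer $1\le d\le n/\gcd(r,n)$): start with $P_j$ the single vertex $(v_1,l+jr)$, $x_j=l+jr$, $0\le j\le d-1$. For $t=1,\dots,m-1$: if $t=1$ put $y_j=x_j$; if $t\ge2$, with $a=\sigma(v_t)$ and $X=\{x_0,\dots,x_{d-1}\}$, let $s_j\ge0$ be least with $x_j+(s_j+1)a\in X$, extend $P_j$ by $(v_t,x_j+a),\dots,(v_t,x_j+s_ja)$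 and put $y_j=x_j+s_ja$. Then extend $P_j$ by the edge $(v_t,y_j)(v_{t+1},y_j+\sigma(v_t,v_{t+1}))$ and set $x_j:=y_j+\sigma(v_t,v_{t+1})$; the final $x_j$ is where $P_j$ arrives in $v_m^\sigma$. Odd shifting path: $(\Gamma,\sigma)$ with $\sigma(v_1)=\sigma(v_m)=r$ (the endpoint voltage) is odd shifting if, running the strategy with $d=2\mathrm{c}(\Gamma)\le n/\gcd(r,n)$, step $r$ and $l=0$, there is an odd $0<s<d$ such that, with $(a_0,\dots,a_{d-1})=(d-s,\dots,d-1,0,\dots,d-s-1)$ and $\beta=l+\sum_{t=1}^{m-1}\sigma(v_t,v_{t+1})-\sum_{t=2}^{m-1}\sigma(v_t)$, the path $P_{a_k}$ arrives in $v_m^\sigma$ at $(v_m,\beta+kr)$ for every $0\le k\le d-1$.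
   Formalization: For n = 2 each end fiber is a single edge that every Hamiltonian cycle must use, so C cannot avoid E^L or E^R; that C omits the edges of E^L and E^R is therefore claimed only for n ≠ 2, while C contains all other edges of the end fibers for every n. *)

theory Defs
  imports Complex_Main
begin

text \<open>
  Undirected graphs without parallel edges; an edge is the set of its end vertices, so the loop at
  \<open>u\<close> is the singleton \<open>{u}\<close>.
\<close>

record 'a ugraph =
  verts :: "'a set"
  edges :: "'a set set"

definition induced_subgraph :: "'a ugraph \<Rightarrow> 'a set \<Rightarrow> 'a ugraph" where
  "induced_subgraph G W = \<lparr>verts = verts G \<inter> W, edges = {e \<in> edges G. e \<subseteq> W}\<rparr>"

definition path_edges :: "'a list \<Rightarrow> 'a set set" where
  "path_edges p = {{p ! i, p ! Suc i} | i. Suc i < length p}"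

definition is_path :: "'a ugraph \<Rightarrow> 'a list \<Rightarrow> bool" where
  "is_path G p \<longleftrightarrow> p \<noteq> [] \<and> distinct p \<and> set p \<subseteq> verts G \<and> path_edges p \<subseteq> edges G"

definition cycle_edges :: "'a list \<Rightarrow> 'a set set" where
  "cycle_edges c = {{c ! i, c ! (Suc i mod length c)} | i. i < length c}"

definition hamiltonian_cycle :: "'a ugraph \<Rightarrow> 'a list \<Rightarrow> bool" where
  "hamiltonian_cycle G c \<longleftrightarrow>
     3 \<le> length c \<and> distinct c \<and> set c = verts G \<and> cycle_edges c \<subseteq> edges G"

definition proper_edge_coloring :: "'a set set \<Rightarrow> ('a set \<Rightarrow> 'c) \<Rightarrow> bool" where
  "proper_edge_coloring F col \<longleftrightarrow>
     (\<forall>e\<in>F. \<forall>f\<in>F. e \<noteq> f \<and> e \<inter> f \<noteq> {} \<longrightarrow> col e \<noteq> col f)"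


datatype 'v arc = Arc 'v 'v | Primary_Loop 'v | Secondary_Loop 'v

fun arc_tail :: "'v arc \<Rightarrow> 'v" where
  "arc_tail (Arc u w) = u"
| "arc_tail (Primary_Loop u) = u"
| "arc_tail (Secondary_Loop u) = u"

fun arc_head :: "'v arc \<Rightarrow> 'v" where
  "arc_head (Arc u w) = w"
| "arc_head (Primary_Loop u) = u"
| "arc_head (Secondary_Loop u) = u"

definition arcs_of :: "'v ugraph \<Rightarrow> 'v arc set" where
  "arcs_of G = {Arc u w | u w. u \<noteq> w \<and> {u, w} \<in> edges G}
     \<union> {Primary_Loop u | u. {u} \<in> edges G} \<union> {Secondary_Loop u | u. {u} \<in> edges G}"

text \<open>The group \<open>\<int>\<^sub>n\<close> is represented by the residues \<open>{0..<int n}\<close>.\<close>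

definition voltage_assignment :: "nat \<Rightarrow> 'v ugraph \<Rightarrow> ('v arc \<Rightarrow> int) \<Rightarrow> bool" where
  "voltage_assignment n G \<sigma> \<longleftrightarrow>
     (\<forall>a\<in>arcs_of G. \<sigma> a \<in> {0..<int n}) \<and>
     (\<forall>u w. Arc u w \<in> arcs_of G \<longrightarrow> \<sigma> (Arc w u) = (- \<sigma> (Arc u w)) mod int n) \<and>
     (\<forall>u. Primary_Loop u \<in> arcs_of G \<longrightarrow>
        \<sigma> (Secondary_Loop u) = (- \<sigma> (Primary_Loop u)) mod int n)"

text \<open>
  The lift is given by an adjacency relation, hence has no parallel edges. In particular, for
  \<open>n = 2\<close> the two loop arcs of voltage 1 give the same edge, and the fiber is a single edge
  rather than a 2-cycle. A Hamiltonian cycle of a lift may then be forced to use that edge.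
\<close>

definition lift :: "nat \<Rightarrow> 'v ugraph \<Rightarrow> ('v arc \<Rightarrow> int) \<Rightarrow> ('v \<times> int) ugraph" where
  "lift n G \<sigma> =
     \<lparr>verts = verts G \<times> {0..<int n},
      edges = {{(u, a), (w, b)} | u a w b. a \<in> {0..<int n} \<and> b \<in> {0..<int n} \<and>
        (\<exists>e\<in>arcs_of G. arc_tail e = u \<and> arc_head e = w \<and> \<sigma> e = (b - a) mod int n)}\<rparr>"

definition fiber :: "nat \<Rightarrow> 'v ugraph \<Rightarrow> ('v arc \<Rightarrow> int) \<Rightarrow> 'v \<Rightarrow> ('v \<times> int) ugraph" where
  "fiber n G \<sigma> u = induced_subgraph (lift n G \<sigma>) ({u} \<times> {0..<int n})"

definition alternating_consecutive ::
    "nat \<Rightarrow> 'v ugraph \<Rightarrow> ('v arc \<Rightarrow> int) \<Rightarrow> 'v \<Rightarrow> ('v \<times> int) set set \<Rightarrow> bool" where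
  "alternating_consecutive n G \<sigma> u E \<longleftrightarrow>
     {u} \<in> edges G \<and> \<sigma> (Primary_Loop u) \<noteq> 0 \<and> E \<subseteq> edges (fiber n G \<sigma> u) \<and>
     (\<exists>p (col :: ('v \<times> int) set \<Rightarrow> bool) k. is_path (fiber n G \<sigma> u) p \<and>
        proper_edge_coloring (path_edges p) col \<and> E = {e \<in> path_edges p. col e = k})"


text \<open>The path has vertices \<open>v 1, \<dots>, v m\<close>; \<open>v\<close> is meant to be injective on \<open>{1..m}\<close>.\<close>

definition reflexive_path :: "nat \<Rightarrow> (nat \<Rightarrow> 'v) \<Rightarrow> 'v ugraph" where
  "reflexive_path m v =
     \<lparr>verts = v ` {1..m},
      edges = {{v t} | t. t \<in> {1..m}} \<union> {{v t, v (Suc t)} | t. t \<in> {1..<m}}\<rparr>"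

definition path_c :: "nat \<Rightarrow> nat \<Rightarrow> (nat \<Rightarrow> 'v) \<Rightarrow> ('v arc \<Rightarrow> int) \<Rightarrow> nat" where
  "path_c n m v \<sigma> =
     (if m = 2 then 1
      else nat \<lceil>real_of_int (Max ((\<lambda>t. gcd (int n) (\<sigma> (Primary_Loop (v t)))) ` {2..m - 1})) / 2\<rceil>)"

text \<open>
  \<open>billiard_step n v \<sigma> d t\<close> is round \<open>t\<close> of the strategy, which takes the paths from the fiber of
  \<open>v t\<close> to that of \<open>v (t + 1)\<close>. The current value \<open>x\<^sub>j\<close> is the second component of the last vertex
  of \<open>P j\<close>.
\<close>

definition billiard_step ::
    "nat \<Rightarrow> (nat \<Rightarrow> 'v) \<Rightarrow> ('v arc \<Rightarrow> int) \<Rightarrow> nat \<Rightarrow> nat \<Rightarrow>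
     (nat \<Rightarrow> ('v \<times> int) list) \<Rightarrow> nat \<Rightarrow> ('v \<times> int) list" where
  "billiard_step n v \<sigma> d t P j =
     (let x = (\<lambda>i. snd (last (P i)));
          a = \<sigma> (Primary_Loop (v t));
          s = (if t = 1 then 0
               else (LEAST s. (x j + (int s + 1) * a) mod int n \<in> x ` {0..<d}));
          y = (x j + int s * a) mod int n
      in P j @ map (\<lambda>i. (v t, (x j + int i * a) mod int n)) [1..<Suc s]
             @ [(v (Suc t), (y + \<sigma> (Arc (v t) (v (Suc t)))) mod int n)])"

primrec billiard_rounds ::
    "nat \<Rightarrow> (nat \<Rightarrow> 'v) \<Rightarrow> ('v arc \<Rightarrow> int) \<Rightarrow> nat \<Rightarrow> int \<Rightarrow> int \<Rightarrow>
     nat \<Rightarrow> nat \<Rightarrow> ('v \<times> int) list" where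
  "billiard_rounds n v \<sigma> d r l 0 = (\<lambda>j. [(v 1, (l + int j * r) mod int n)])"
| "billiard_rounds n v \<sigma> d r l (Suc t) =
     billiard_step n v \<sigma> d (Suc t) (billiard_rounds n v \<sigma> d r l t)"

definition billiard ::
    "nat \<Rightarrow> nat \<Rightarrow> (nat \<Rightarrow> 'v) \<Rightarrow> ('v arc \<Rightarrow> int) \<Rightarrow> nat \<Rightarrow> int \<Rightarrow> int \<Rightarrow>
     nat \<Rightarrow> ('v \<times> int) list" where
  "billiard n m v \<sigma> d r l = billiard_rounds n v \<sigma> d r l (m - 1)"

definition odd_shifting ::
    "nat \<Rightarrow> nat \<Rightarrow> (nat \<Rightarrow> 'v) \<Rightarrow> ('v arc \<Rightarrow> int) \<Rightarrow> int \<Rightarrow> bool" where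
  "odd_shifting n m v \<sigma> r \<longleftrightarrow>
     \<sigma> (Primary_Loop (v 1)) = r \<and> \<sigma> (Primary_Loop (v m)) = r \<and>
     (let d = 2 * path_c n m v \<sigma>;
          l = 0;
          P = billiard n m v \<sigma> d r l;
          \<beta> = l + (\<Sum>t = 1..m - 1. \<sigma> (Arc (v t) (v (Suc t))))
                - (\<Sum>t = 2..m - 1. \<sigma> (Primary_Loop (v t)))
      in int d \<le> int n div gcd r (int n) \<and>
         (\<exists>s. odd s \<and> 0 < s \<and> s < d \<and>
            (\<forall>k<d. last (P (([d - s..<d] @ [0..<d - s]) ! k)) = (v m, (\<beta> + int k * r) mod int n))))"

end

theory Submission
  imports Defs
begin

text \<open>
  In every intermediate fiber the paths leave from the set where they arrived, shifted by minus the
  loop voltage: a path stops one step before the next arrival point. So the arrival set remains the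
  progression \<open>\<beta> + k r\<close> with \<open>k < d\<close>, and as \<open>d\<close> is at least the number of cosets of the next loop
  voltage, the paths partition the next fiber.

  The two end fibers are cycles of step \<open>r\<close>. Deleting every second edge among their first \<open>d\<close>
  vertices joins \<open>P\<^sub>j\<close> and \<open>P\<^sub>j\<^sub>+\<^sub>1\<close> (indices modulo \<open>d\<close>) on the left for odd \<open>j\<close>, and on the right for
  even \<open>j\<close> because the shift \<open>s\<close> is odd. Hence \<open>P\<^sub>0, P\<^sub>1, \<dots>, P\<^sub>d\<^sub>-\<^sub>1\<close>, traversed in alternating
  directions, close up to a single cycle.
\<close>

section \<open>Edge sets of concatenated and reversed lists\<close>

lemma path_edges_Nil [simp]: "path_edges [] = {}"
  and path_edges_singleton [simp]: "path_edges [x] = {}"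
  by (auto simp: path_edges_def)

lemma path_edges_Cons_Cons [simp]:
  "path_edges (x # y # zs) = insert {x, y} (path_edges (y # zs))"
proof -
  have "path_edges (x # y # zs) = (\<lambda>i. {(x # y # zs) ! i, (y # zs) ! i}) ` {..<Suc (length zs)}"
    by (auto simp: path_edges_def)
  also have "{..<Suc (length zs)} = insert 0 (Suc ` {..<length zs})"
    by (auto simp: lessThan_Suc_eq_insert_0)
  also have "(\<lambda>i. {(x # y # zs) ! i, (y # zs) ! i}) ` \<dots> = insert {x, y} (path_edges (y # zs))"
    by (simp add: path_edges_def image_image) blast
  finally show ?thesis .
qed

lemma path_edges_Cons:
  "ys \<noteq> [] \<Longrightarrow> path_edges (x # ys) = insert {x, hd ys} (path_edges ys)"
  by (cases ys) auto

lemma path_edges_append: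
  assumes "xs \<noteq> []" "ys \<noteq> []"
  shows "path_edges (xs @ ys) = insert {last xs, hd ys} (path_edges xs \<union> path_edges ys)"
  using assms
proof (induction xs)
  case (Cons x xs)
  then show ?case by (cases "xs = []") (auto simp: path_edges_Cons)
qed simp

lemma path_edges_append_overlap:
  "path_edges (xs @ y # ys) = path_edges (xs @ [y]) \<union> path_edges (y # ys)"
  by (cases "xs = []") (auto simp: path_edges_append)

lemma path_edges_rev [simp]: "path_edges (rev xs) = path_edges xs"
proof (induction xs)
  case (Cons x xs)
  then show ?case
    by (cases "xs = []") (auto simp: path_edges_Cons path_edges_append last_rev insert_commute)
qed simp

lemma path_edges_subset_set: "e \<in> path_edges p \<Longrightarrow> e \<subseteq> set p"
  by (auto simp: path_edges_def)

lemma path_edges_map_upt: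
  "path_edges (map f [a..<b]) = (\<lambda>i. {f i, f (Suc i)}) ` {a..<b - 1}"
proof -
  have "path_edges (map f [a..<b]) =
      (\<lambda>i. {map f [a..<b] ! i, map f [a..<b] ! Suc i}) ` {i. Suc i < b - a}"
    by (simp only: path_edges_def length_map length_upt setcompr_eq_image)
  also have "\<dots> = (\<lambda>i. {f (a + i), f (Suc (a + i))}) ` {i. Suc i < b - a}"
    by (rule image_cong) auto
  also have "\<dots> = (\<lambda>i. {f i, f (Suc i)}) ` ((+) a ` {i. Suc i < b - a})"
    by (simp add: image_image)
  also have "(+) a ` {i. Suc i < b - a} = {a..<b - 1}"
  proof (intro equalityI subsetI)
    fix x assume "x \<in> {a..<b - 1}"
    then show "x \<in> (+) a ` {i. Suc i < b - a}"
      by (intro image_eqI[of _ _ "x - a"]) auto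
  qed auto
  finally show ?thesis .
qed

text \<open>The condition \<open>hd xs = f b\<close> turns the joining edge into the step from
  \<open>b - 1\<close> to \<open>b\<close>. The case \<open>a = b\<close> covers a fiber with no
  vertices left over.\<close>

lemma path_edges_map_upt_append:
  assumes "a \<le> b" "xs \<noteq> []" "hd xs = f b"
  shows "path_edges (map f [a..<b] @ xs) = (\<lambda>i. {f i, f (Suc i)}) ` {a..<b} \<union> path_edges xs"
proof (cases "a = b")
  case False
  with assms have ab: "a < b" by simp
  then have "last (map f [a..<b]) = f (b - 1)" by (simp add: last_map)
  moreover have "{a..<b} = insert (b - 1) {a..<b - 1}" using ab by auto
  moreover have "Suc (b - 1) = b" using ab by simp
  ultimately show ?thesis
    using assms ab by (simp add: path_edges_append path_edges_map_upt)
qed simp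

lemma cycle_edges_eq_insert_path_edges:
  assumes "c \<noteq> []"
  shows "cycle_edges c = insert {last c, hd c} (path_edges c)"
proof -
  have *: "{..<length c} = insert (length c - 1) {i. Suc i < length c}"
    using assms by (auto simp: less_Suc_eq)
  have "cycle_edges c = (\<lambda>i. {c ! i, c ! (Suc i mod length c)}) ` {..<length c}"
    by (auto simp: cycle_edges_def)
  also have "\<dots> = insert {last c, hd c} (path_edges c)"
    unfolding * using assms by (auto simp: path_edges_def last_conv_nth hd_conv_nth)
  finally show ?thesis .
qed

lemma hd_last_path_edges_concat:
  assumes "0 < d" "\<And>j. j < d \<Longrightarrow> R j \<noteq> []"
  shows "concat (map R [0..<d]) \<noteq> []"
    and "hd (concat (map R [0..<d])) = hd (R 0)"
    and "last (concat (map R [0..<d])) = last (R (d - 1))"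
    and "path_edges (concat (map R [0..<d])) =
      (\<Union>j<d. path_edges (R j)) \<union> (\<lambda>j. {last (R j), hd (R (Suc j))}) ` {..<d - 1}"
proof -
  \<comment> \<open>Counting up to \<open>Suc d\<close> makes a single block the base case, so
    \<open>hd\<close> and \<open>last\<close> are always taken of nonempty lists.\<close>
  have "concat (map R [0..<Suc d]) \<noteq> [] \<and> hd (concat (map R [0..<Suc d])) = hd (R 0) \<and>
    last (concat (map R [0..<Suc d])) = last (R d) \<and>
    path_edges (concat (map R [0..<Suc d])) =
      (\<Union>j<Suc d. path_edges (R j)) \<union> (\<lambda>j. {last (R j), hd (R (Suc j))}) ` {..<d}"
    if "\<And>j. j < Suc d \<Longrightarrow> R j \<noteq> []" for d
    using that
  proof (induction d)
    case (Suc d)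
    then have IH: "concat (map R [0..<Suc d]) \<noteq> []" 
       "hd (concat (map R [0..<Suc d])) = hd (R 0)"
       "last (concat (map R [0..<Suc d])) = last (R d)"
       "path_edges (concat (map R [0..<Suc d])) =
      (\<Union>j<Suc d. path_edges (R j)) \<union> (\<lambda>j. {last (R j), hd (R (Suc j))}) ` {..<d}"
      by simp_all
    have eq: "concat (map R [0..<Suc (Suc d)]) = concat (map R [0..<Suc d]) @ R (Suc d)"
      by simp
    have ne: "R (Suc d) \<noteq> []" using Suc.prems by simp
    show ?case
      unfolding eq path_edges_append[OF IH(1) ne] IH(3,4)
      using IH(1,2) ne by (auto simp: lessThan_Suc simp del: upt_Suc)
  qed auto
  from this[of "d - 1"] assms
  show "concat (map R [0..<d]) \<noteq> []"
    and "hd (concat (map R [0..<d])) = hd (R 0)"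
    and "last (concat (map R [0..<d])) = last (R (d - 1))"
    and "path_edges (concat (map R [0..<d])) =
      (\<Union>j<d. path_edges (R j)) \<union> (\<lambda>j. {last (R j), hd (R (Suc j))}) ` {..<d - 1}"
    by simp_all
qed

lemma cycle_edges_concat:
  assumes "0 < d" "\<And>j. j < d \<Longrightarrow> R j \<noteq> []"
  shows "cycle_edges (concat (map R [0..<d])) =
      (\<Union>j<d. path_edges (R j)) \<union> (\<lambda>j. {last (R j), hd (R (Suc j mod d))}) ` {..<d}"
proof -
  have *: "{..<d} = insert (d - 1) {..<d - 1}" using assms by auto
  have "(\<lambda>j. {last (R j), hd (R (Suc j mod d))}) ` {..<d} =
     insert {last (R (d - 1)), hd (R 0)} ((\<lambda>j. {last (R j), hd (R (Suc j mod d))}) ` {..<d - 1})"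
    unfolding * using assms(1) by simp
  also have "(\<lambda>j. {last (R j), hd (R (Suc j mod d))}) ` {..<d - 1} =
      (\<lambda>j. {last (R j), hd (R (Suc j))}) ` {..<d - 1}"
    by (rule image_cong) auto
  finally show ?thesis
    using hd_last_path_edges_concat[OF assms] by (simp add: cycle_edges_eq_insert_path_edges)
qed

subsection \<open>Closing up paths between two cyclic fibers\<close>

text \<open>\<open>A\<close> and \<open>B\<close> stand for the end fibers, read cyclically:
  position \<open>n\<close> is position 0 again, so the edges \<open>{A i, A (Suc i)}\<close> with
  \<open>i < n\<close> close up. The paths keep to the first \<open>d\<close> positions, which
  leaves the others free for a detour.\<close>

locale zigzag =
  fixes A B :: "nat \<Rightarrow> 'a" and P :: "nat \<Rightarrow> 'a list" and n d s :: nat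
  assumes d_even: "even d" and d_pos: "0 < d" and d_le: "d \<le> n" and s_odd: "odd s"
    and A_n: "A n = A 0" and B_n: "B n = B 0"
    and A_inj: "inj_on A {..<n}" and B_inj: "inj_on B {..<n}"
    and A_B: "A ` {..<n} \<inter> B ` {..<n} = {}"
    and P_ne: "j < d \<Longrightarrow> P j \<noteq> []"
    and P_distinct: "j < d \<Longrightarrow> distinct (P j)"
    and P_hd: "j < d \<Longrightarrow> hd (P j) = A j"
    and P_last: "j < d \<Longrightarrow> last (P j) = B ((j + s) mod d)"
    and P_disjoint: "i < d \<Longrightarrow> j < d \<Longrightarrow> i \<noteq> j \<Longrightarrow> set (P i) \<inter> set (P j) = {}"
    and P_A: "j < d \<Longrightarrow> set (P j) \<inter> A ` {d..<n} = {}"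
    and P_B: "j < d \<Longrightarrow> set (P j) \<inter> B ` {d..<n} = {}"
begin

text \<open>
  The path that ends at position 0 of an end fiber also takes the remaining vertices
  \<open>n - 1, \<dots>, d\<close> of that fiber, so that it effectively ends at position \<open>d\<close>.
\<close>

definition ext :: "(nat \<Rightarrow> 'a) \<Rightarrow> nat \<Rightarrow> 'a list" where
  "ext f k = (if k = 0 then map f [d..<n] else [])"

text \<open>The right stretch is reversed because \<open>P j\<close> arrives at
  \<open>B 0 = B n\<close> and walks down to \<open>B d\<close>, whereas the left stretch climbs
  from \<open>A d\<close> to \<open>A n = A 0\<close>.\<close>

definition Q :: "nat \<Rightarrow> 'a list" where
  "Q j = ext A j @ P j @ rev (ext B ((j + s) mod d))"

definition C :: "'a list" where
  "C = concat (map (\<lambda>j. if even j then Q j else rev (Q j)) [0..<d])"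

lemma Q_ne: "j < d \<Longrightarrow> Q j \<noteq> []"
  by (simp add: Q_def P_ne)

text \<open>If \<open>d = n\<close>, the added stretch is empty and the claim survives because
  \<open>f n = f 0\<close>.\<close>

lemma hd_ext:
  assumes "xs \<noteq> []" "hd xs = f k" "f n = f 0"
  shows "hd (ext f k @ xs) = f (if k = 0 then d else k)"
proof (cases "k = 0 \<and> d < n")
  case True
  then show ?thesis by (simp add: ext_def hd_append hd_map)
next
  case False
  then have "k = 0 \<Longrightarrow> d = n" using d_le by simp
  then show ?thesis using assms by (auto simp: ext_def)
qed

lemma path_edges_ext:
  assumes "xs \<noteq> []" "hd xs = f k" "f n = f 0"
  shows "path_edges (ext f k @ xs) =
    path_edges xs \<union> (if k = 0 then (\<lambda>i. {f i, f (Suc i)}) ` {d..<n} else {})"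
  using path_edges_map_upt_append[OF d_le assms(1), of f] assms by (auto simp: ext_def)

lemma hd_Q: "j < d \<Longrightarrow> hd (Q j) = A (if j = 0 then d else j)"
  unfolding Q_def by (intro hd_ext) (auto simp: P_ne P_hd A_n)

lemma last_Q:
  assumes "j < d"
  shows "last (Q j) = B (if (j + s) mod d = 0 then d else (j + s) mod d)"
proof -
  have "last (Q j) = hd (ext B ((j + s) mod d) @ rev (ext A j @ P j))"
    using Q_ne[OF assms] by (simp add: hd_rev[symmetric] Q_def)
  also have "\<dots> = B (if (j + s) mod d = 0 then d else (j + s) mod d)"
    using assms by (intro hd_ext) (auto simp: P_ne P_last B_n hd_rev)
  finally show ?thesis .
qed

lemma path_edges_Q:
  assumes "j < d"
  shows "path_edges (Q j) = path_edges (P j)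
    \<union> (if j = 0 then (\<lambda>i. {A i, A (Suc i)}) ` {d..<n} else {})
    \<union> (if (j + s) mod d = 0 then (\<lambda>i. {B i, B (Suc i)}) ` {d..<n} else {})"
proof -
  have "path_edges (Q j) = path_edges (P j @ rev (ext B ((j + s) mod d)))
    \<union> (if j = 0 then (\<lambda>i. {A i, A (Suc i)}) ` {d..<n} else {})"
    unfolding Q_def using assms by (intro path_edges_ext) (auto simp: P_ne P_hd A_n)
  also have "path_edges (P j @ rev (ext B ((j + s) mod d))) =
     path_edges (ext B ((j + s) mod d) @ rev (P j))"
    by (subst path_edges_rev[symmetric]) simp
  also have "\<dots> = path_edges (rev (P j))
    \<union> (if (j + s) mod d = 0 then (\<lambda>i. {B i, B (Suc i)}) ` {d..<n} else {})"
    using assms by (intro path_edges_ext) (auto simp: P_ne P_last B_n hd_rev)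
  finally show ?thesis by auto
qed

lemma ex_index:
  assumes "k < d" shows "\<exists>j<d. (j + s) mod d = k"
proof -
  \<comment> \<open>Subtraction of \<open>s\<close> modulo \<open>d\<close>; reducing
    \<open>s\<close> first keeps the difference of naturals from being truncated.\<close>
  define j where "j = (k + (d - s mod d)) mod d"
  have "j < d" using d_pos by (simp add: j_def)
  moreover have "(j + s) mod d = (k + (d - s mod d) + s mod d) mod d"
    unfolding j_def by (metis mod_add_left_eq mod_add_right_eq)
  moreover have "k + (d - s mod d) + s mod d = k + d"
    using mod_less_divisor[OF d_pos, of s] by linarith
  ultimately have "j < d" "(j + s) mod d = k"
    using assms by simp_all
  then show ?thesis by blast
qed

text \<open>Reduction modulo the even \<open>d\<close> preserves parity, and adding the odd
  \<open>s\<close> flips it. This is where the odd shift enters.\<close>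

lemma even_index: "even ((j + s) mod d) \<longleftrightarrow> odd j"
  using d_even s_odd by (simp add: dvd_mod_iff)

lemma index_inj:
  assumes "i < d" "j < d" "(i + s) mod d = (j + s) mod d" shows "i = j"
proof -
  have *: "i = j" if "i < d" "j < d" "(i + s) mod d = (j + s) mod d" "i \<le> j" for i j
  proof -
    have "d dvd (j + s) - (i + s)"
      using that by (subst mod_eq_dvd_iff_nat[symmetric]) auto
    then show ?thesis using that by (auto dest: dvd_imp_le)
  qed
  show ?thesis using *[of i j] *[of j i] assms by linarith
qed

lemma set_Q:
  "set (Q j) = set (P j) \<union> (if j = 0 then A ` {d..<n} else {})
    \<union> (if (j + s) mod d = 0 then B ` {d..<n} else {})"
  by (auto simp: Q_def ext_def)

lemma A_B_far: "A ` {d..<n} \<inter> B ` {d..<n} = {}"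
proof -
  have "A ` {d..<n} \<subseteq> A ` {..<n}" "B ` {d..<n} \<subseteq> B ` {..<n}" by auto
  then show ?thesis using A_B by blast
qed

lemma distinct_Q:
  assumes "j < d" shows "distinct (Q j)"
proof -
  have "inj_on A {d..<n}" "inj_on B {d..<n}"
    by (auto intro: inj_on_subset[OF A_inj] inj_on_subset[OF B_inj])
  then show ?thesis
    using P_distinct[OF assms] P_A[OF assms] P_B[OF assms] A_B_far
    by (auto simp: Q_def ext_def distinct_map)
qed

lemma disjoint_Q:
  assumes "i < d" "j < d" "i \<noteq> j" shows "set (Q i) \<inter> set (Q j) = {}"
proof -
  have *: "\<not> ((i + s) mod d = 0 \<and> (j + s) mod d = 0)"
    using index_inj[OF assms(1,2)] assms(3) by metis
  \<comment> \<open>A Boolean fact about sets: each far stretch is attached to at most one of the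
    two lists, the left one to index 0 and the right one to the unique index that \<open>s\<close>
    moves to 0.\<close>
  have "X \<inter> Y = {}" if "X = pX \<union> (if zX then FA else {}) \<union> (if oX then FB else {})"
    "Y = pY \<union> (if zY then FA else {}) \<union> (if oY then FB else {})"
    "pX \<inter> pY = {}" "pX \<inter> FA = {}" "pX \<inter> FB = {}" "pY \<inter> FA = {}" "pY \<inter> FB = {}"
    "FA \<inter> FB = {}" "\<not> (oX \<and> oY)" "\<not> (zX \<and> zY)"
    for X Y pX pY FA FB :: "'a set" and zX zY oX oY
    using that by (auto split: if_splits)
  from this[OF set_Q set_Q P_disjoint[OF assms] P_A[OF assms(1)] P_B[OF assms(1)]
      P_A[OF assms(2)] P_B[OF assms(2)] A_B_far *]
  show ?thesis using assms by blast
qed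

lemma set_C: "set C = (\<Union>j<d. set (P j)) \<union> A ` {d..<n} \<union> B ` {d..<n}"
proof -
  have "set C = (\<Union>j<d. set (Q j))"
    by (auto simp: C_def)
  also have "\<dots> = (\<Union>j<d. set (P j)) \<union> A ` {d..<n} \<union> B ` {d..<n}"
    unfolding set_Q using d_pos ex_index[OF d_pos] by (auto split: if_splits)
  finally show ?thesis .
qed

lemma distinct_C: "distinct C"
proof -
  \<comment> \<open>Generalised to prefixes, so that the induction adds one \<open>Q k\<close>
    disjoint from all earlier ones.\<close>
  have "distinct (concat (map (\<lambda>j. if even j then Q j else rev (Q j)) [0..<k]))" if "k \<le> d" for k
    using that
  proof (induction k)
    case (Suc k)
    moreover have "set (Q j) \<inter> set (Q k) = {}" if "j < k" for j
      using disjoint_Q[of j k] that Suc.prems by simp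
    ultimately show ?case using distinct_Q[of k] by (auto simp: disjoint_iff)
  qed simp
  then show ?thesis by (simp add: C_def)
qed

lemma cycle_edges_C:
  "cycle_edges C = (\<Union>j<d. path_edges (P j))
    \<union> (\<lambda>i. {A i, A (Suc i)}) ` {i. i < n \<and> (odd i \<or> d \<le> i)}
    \<union> (\<lambda>i. {B i, B (Suc i)}) ` {i. i < n \<and> (odd i \<or> d \<le> i)}"
proof -
  define R where "R = (\<lambda>j. if even j then Q j else rev (Q j))"
  have R_ne: "R j \<noteq> []" if "j < d" for j
    using Q_ne[OF that] by (simp add: R_def)
  have split: "{i. i < n \<and> (odd i \<or> d \<le> i)} = {i. i < d \<and> odd i} \<union> {d..<n}"
    using d_le by auto
  have 1: "(\<Union>j<d. path_edges (R j)) = (\<Union>j<d. path_edges (P j))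
     \<union> (\<lambda>i. {A i, A (Suc i)}) ` {d..<n} \<union> (\<lambda>i. {B i, B (Suc i)}) ` {d..<n}"
  proof -
    have "(\<Union>j<d. path_edges (R j)) = (\<Union>j<d. path_edges (Q j))"
      by (intro SUP_cong) (simp_all add: R_def)
    also have "\<dots> = (\<Union>j<d. path_edges (P j)
      \<union> (if j = 0 then (\<lambda>i. {A i, A (Suc i)}) ` {d..<n} else {})
      \<union> (if (j + s) mod d = 0 then (\<lambda>i. {B i, B (Suc i)}) ` {d..<n} else {}))"
      by (intro SUP_cong) (simp_all add: path_edges_Q)
    also have "\<dots> = (\<Union>j<d. path_edges (P j))
      \<union> (\<lambda>i. {A i, A (Suc i)}) ` {d..<n} \<union> (\<lambda>i. {B i, B (Suc i)}) ` {d..<n}"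
      using d_pos ex_index[OF d_pos] by (auto split: if_splits)
    finally show ?thesis .
  qed
  \<comment> \<open>An odd \<open>j\<close> is walked right to left and ends at \<open>A j\<close>;
    the next list starts at \<open>A (Suc j)\<close>. The closing join fits too, since the extended
    \<open>Q 0\<close> starts at \<open>A d\<close>.\<close>
  have odd_join: "{last (R j), hd (R (Suc j mod d))} = {A j, A (Suc j)}" if j: "j < d" "odd j" for j
  proof -
    have "Suc j mod d < d" "even (Suc j mod d)"
      using d_pos d_even j by (auto simp: dvd_mod_iff)
    then have "hd (R (Suc j mod d)) = A (if Suc j mod d = 0 then d else Suc j mod d)"
      by (simp add: R_def hd_Q)
    also have "(if Suc j mod d = 0 then d else Suc j mod d) = Suc j"
      using j by (cases "Suc j = d") auto
    finally show ?thesis using j by (auto simp: R_def last_rev hd_Q)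
  qed
  have even_join: "{last (R j), hd (R (Suc j mod d))} = {B ((j + s) mod d), B (Suc ((j + s) mod d))}"
    if j: "j < d" "even j" for j
  proof -
    define k where "k = (j + s) mod d"
    have k: "k < d" "odd k" using d_pos even_index[of j] j by (auto simp: k_def)
    \<comment> \<open>Both \<open>j\<close> and \<open>d\<close> are even, so a join on the right
      never wraps around to index 0; only the position \<open>Suc k\<close> may equal
      \<open>d\<close>.\<close>
    have "Suc j < d" using j d_even by (metis Suc_lessI even_Suc)
    then have "hd (R (Suc j mod d)) =
        B (if (Suc j + s) mod d = 0 then d else (Suc j + s) mod d)"
      using j by (simp add: R_def hd_rev last_Q)
    also have "(Suc j + s) mod d = Suc k mod d"
      by (simp add: k_def mod_Suc_eq)
    also have "(if Suc k mod d = 0 then d else Suc k mod d) = Suc k"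
      using k by (cases "Suc k = d") auto
    finally show ?thesis using j k by (auto simp: R_def last_Q k_def)
  qed
  have 2: "(\<lambda>j. {last (R j), hd (R (Suc j mod d))}) ` {..<d} =
     (\<lambda>i. {A i, A (Suc i)}) ` {i. i < d \<and> odd i} \<union> (\<lambda>i. {B i, B (Suc i)}) ` {i. i < d \<and> odd i}"
  proof -
    have "{..<d} = {i. i < d \<and> odd i} \<union> {i. i < d \<and> even i}" by auto
    then have "(\<lambda>j. {last (R j), hd (R (Suc j mod d))}) ` {..<d} =
       (\<lambda>i. {A i, A (Suc i)}) ` {i. i < d \<and> odd i} \<union>
       (\<lambda>i. {B ((i + s) mod d), B (Suc ((i + s) mod d))}) ` {i. i < d \<and> even i}"
      by (simp only: image_Un) (intro arg_cong2[where f = "(\<union>)"] image_cong;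
        simp add: odd_join even_join)
    also have "(\<lambda>i. {B ((i + s) mod d), B (Suc ((i + s) mod d))}) ` {i. i < d \<and> even i} =
      (\<lambda>i. {B i, B (Suc i)}) ` ((\<lambda>i. (i + s) mod d) ` {i. i < d \<and> even i})"
      by (simp add: image_image)
    \<comment> \<open>By the parity flip, the even path indices correspond exactly to the odd
      positions on the right, so both fibers keep the same pattern of edges.\<close>
    also have "(\<lambda>i. (i + s) mod d) ` {i. i < d \<and> even i} = {i. i < d \<and> odd i}"
    proof (intro equalityI subsetI)
      fix k assume "k \<in> {i. i < d \<and> odd i}"
      then obtain j where "j < d" "(j + s) mod d = k" "odd k" using ex_index[of k] by blast
      with even_index[of j] show "k \<in> (\<lambda>i. (i + s) mod d) ` {i. i < d \<and> even i}" by auto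
    next
      fix k assume "k \<in> (\<lambda>i. (i + s) mod d) ` {i. i < d \<and> even i}"
      then obtain i where "even i" "k = (i + s) mod d" by blast
      with d_pos even_index[of i] show "k \<in> {i. i < d \<and> odd i}" by simp
    qed
    finally show ?thesis .
  qed
  have "cycle_edges C = (\<Union>j<d. path_edges (R j)) \<union>
    (\<lambda>j. {last (R j), hd (R (Suc j mod d))}) ` {..<d}"
    unfolding C_def R_def[symmetric] by (rule cycle_edges_concat) (use d_pos R_ne in auto)
  then show ?thesis
    unfolding 1 2 split image_Un by blast
qed

end

subsection \<open>Arithmetic progressions and orbit segments modulo n\<close>

lemma inj_on_progression_mod:
  fixes c r :: int
  assumes "coprime r (int n)"
  shows "inj_on (\<lambda>i. (c + int i * r) mod int n) {..<n}"
proof (rule inj_onI)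
  fix i j assume ij: "i \<in> {..<n}" "j \<in> {..<n}"
    and eq: "(c + int i * r) mod int n = (c + int j * r) mod int n"
  from eq have "int n dvd (c + int i * r) - (c + int j * r)"
    by (simp only: mod_eq_dvd_iff)
  then have "int n dvd (int i - int j) * r" by (simp add: algebra_simps)
  then have "int n dvd int i - int j"
    using assms by (simp add: coprime_dvd_mult_left_iff coprime_commute)
  then show "i = j"
    using ij by (metis lessThan_iff mod_eq_dvd_iff of_nat_eq_iff zmod_int mod_less)
qed

lemma progression_mod_image:
  fixes c r :: int
  assumes "coprime r (int n)"
  shows "(\<lambda>i. (c + int i * r) mod int n) ` {..<n} = {0..<int n}"
proof (cases "n = 0")
  case False
  then show ?thesis
    by (intro card_subset_eq) (auto simp: card_image inj_on_progression_mod[OF assms])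
qed simp

lemma inj_on_add_mod:
  fixes c :: int shows "inj_on (\<lambda>z. (z + c) mod int n) {0..<int n}"
proof (rule inj_onI)
  fix y z assume yz: "y \<in> {0..<int n}" "z \<in> {0..<int n}" "(y + c) mod int n = (z + c) mod int n"
  then have "int n dvd (y + c) - (z + c)" by (simp only: mod_eq_dvd_iff)
  then have "y mod int n = z mod int n" by (simp add: mod_eq_dvd_iff)
  with yz show "y = z" by simp
qed

text \<open>Modulo \<open>n\<close> the multiples of \<open>a\<close> are those of
  \<open>g = gcd n a\<close>, and \<open>r\<close> is a unit modulo \<open>g\<close>, so
  \<open>g\<close> consecutive terms of the progression meet every coset.\<close>

lemma progression_reaches_coset:
  fixes a c r z :: int
  assumes n: "1 \<le> n" and co: "coprime r (int n)" and g: "gcd (int n) a \<le> int d"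
  shows "\<exists>k<d. \<exists>q::nat. (c + int k * r + int q * a) mod int n = z mod int n"
proof -
  define g where "g = gcd (int n) a"
  have g_pos: "0 < g" using n by (simp add: g_def)
  have g_dvd: "g dvd int n" by (simp add: g_def)
  from bezout_int[of r "int n"] co obtain u w where uw: "u * r + w * int n = 1"
    by (auto simp: coprime_iff_gcd_eq_1)
  \<comment> \<open>\<open>u\<close> inverts \<open>r\<close> modulo \<open>n\<close>, hence modulo
    \<open>g\<close>; this \<open>k\<close> solves \<open>k * r = z - c\<close> modulo
    \<open>g\<close>.\<close>
  define k where "k = ((z - c) * u) mod g"
  have k: "0 \<le> k" "k < g" using g_pos by (simp_all add: k_def)
  have "g dvd (z - c) * u - k"
    by (simp add: k_def minus_mod_eq_mult_div)
  then have "g dvd ((z - c) * u - k) * r + (z - c) * w * int n"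
    using g_dvd by simp
  also have "((z - c) * u - k) * r + (z - c) * w * int n = (z - c) * (u * r + w * int n) - k * r"
    by (simp add: algebra_simps)
  finally have "g dvd z - c - k * r" by (simp add: uw)
  then obtain h where h: "z - c - k * r = g * h" by (elim dvdE)
  from bezout_int[of "int n" a] obtain p q where pq: "p * int n + q * a = g"
    by (auto simp: g_def)
  \<comment> \<open>Since \<open>q * a\<close> is \<open>g\<close> modulo \<open>n\<close>, the
    remaining difference \<open>g * h\<close> takes \<open>h * q\<close> steps; reduction modulo
    \<open>n\<close> makes this a natural number.\<close>
  define q' where "q' = nat ((h * q) mod int n)"
  have q': "int q' = (h * q) mod int n" using n by (simp add: q'_def)
  have "(c + k * r + int q' * a) mod int n = (c + k * r + h * q * a) mod int n"
    unfolding q' by (metis mod_add_right_eq mod_mult_left_eq)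
  also have "c + k * r + h * q * a = z - h * p * int n"
    using h unfolding pq[symmetric] by (simp add: algebra_simps)
  also have "(z - h * p * int n) mod int n = z mod int n"
    by (simp add: mod_eq_dvd_iff)
  finally have "(c + int (nat k) * r + int q' * a) mod int n = z mod int n"
    using k by simp
  moreover have "nat k < d" using k g unfolding g_def by linarith
  ultimately show ?thesis by blast
qed

text \<open>Following \<open>z \<mapsto> z + a\<close> from each start \<open>x j\<close> until just before the next start partitions the
  cosets of \<open>a\<close> that meet the set of starts.\<close>

locale orbit_segments =
  fixes n d :: nat and a :: int and x :: "nat \<Rightarrow> int"
  assumes n_pos: "1 \<le> n" and x_range: "j < d \<Longrightarrow> x j \<in> {0..<int n}"
    and x_inj: "inj_on x {0..<d}"
begin

definition steps :: "nat \<Rightarrow> nat" where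
  "steps j = (LEAST s. (x j + (int s + 1) * a) mod int n \<in> x ` {0..<d})"

lemma steps_hit:
  assumes "j < d" shows "(x j + (int (steps j) + 1) * a) mod int n \<in> x ` {0..<d}"
  unfolding steps_def
proof (rule LeastI)
  \<comment> \<open>After \<open>n\<close> steps the orbit is back at its own start, so the
    \<open>LEAST\<close> has a witness.\<close>
  show "(x j + (int (n - 1) + 1) * a) mod int n \<in> x ` {0..<d}"
    using x_range[OF assms] n_pos assms by (simp add: of_nat_diff)
qed

lemma steps_least:
  "s < steps j \<Longrightarrow> (x j + (int s + 1) * a) mod int n \<notin> x ` {0..<d}"
  unfolding steps_def by (rule not_less_Least)

text \<open>Cancelling the common number of steps gives a start that is \<open>q - p\<close> steps
  ahead of another one, still within its segment. For \<open>q > p\<close> this contradicts the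
  minimality of \<open>steps\<close>.\<close>

lemma segment_inj:
  assumes "i < d" "j < d" "p \<le> steps i" "q \<le> steps j"
    and "(x i + int p * a) mod int n = (x j + int q * a) mod int n"
  shows "i = j \<and> p = q"
proof -
  have *: "i = j \<and> p = q"
    if "i < d" "j < d" "p \<le> q" "q \<le> steps j"
      and eq: "(x i + int p * a) mod int n = (x j + int q * a) mod int n" for i j p q
  proof -
    have "(x j + int (q - p) * a) mod int n = ((x j + int q * a) mod int n - int p * a) mod int n"
      using that by (simp add: mod_simps algebra_simps of_nat_diff)
    also have "\<dots> = x i"
      using x_range[of i] that by (simp add: eq[symmetric] mod_simps)
    finally have closer: "(x j + int (q - p) * a) mod int n = x i" .
    have "q = p"
    proof (rule ccontr)
      assume "q \<noteq> p"
      with that have "q - p = Suc (q - p - 1)" "q - p - 1 < steps j" by simp_all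
      with steps_least[of "q - p - 1" j] closer \<open>i < d\<close> show False
        by (metis add.commute atLeast0LessThan image_eqI lessThan_iff of_nat_Suc)
    qed
    with closer x_inj x_range[of j] that show ?thesis by (auto dest: inj_onD)
  qed
  show ?thesis
    using *[of i j p q] *[of j i q p] assms by (cases "p \<le> q") auto
qed

text \<open>One step past the end of a segment lies another start; restarting there leaves strictly
  fewer steps.\<close>

lemma segment_cover:
  assumes "j < d" "(x j + int q * a) mod int n = z"
  shows "\<exists>j<d. \<exists>q\<le>steps j. (x j + int q * a) mod int n = z"
  using assms
proof (induction q arbitrary: j rule: less_induct)
  case (less q)
  show ?case
  proof (cases "q \<le> steps j")
    case False
    from steps_hit[OF less.prems(1)] obtain i
      where i: "i < d" "x i = (x j + (int (steps j) + 1) * a) mod int n" by auto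
    have "(x i + int (q - Suc (steps j)) * a) mod int n = (x j + int q * a) mod int n"
      using False unfolding i(2) mod_add_left_eq
      by (intro arg_cong2[where f = "(mod)"]) (simp_all add: algebra_simps of_nat_diff)
    with less.IH[of "q - Suc (steps j)" i] less.prems i False show ?thesis by auto
  qed (use less.prems in blast)
qed

text \<open>Distinct segments have distinct ends, so the map to the next start is an injection of a
  finite set into itself, hence a permutation.\<close>

lemma segment_ends:
  "(\<lambda>j. (x j + (int (steps j) + 1) * a) mod int n) ` {0..<d} = x ` {0..<d}"
proof (rule card_subset_eq)
  have "inj_on (\<lambda>j. (x j + (int (steps j) + 1) * a) mod int n) {0..<d}"
  proof (rule inj_onI)
    fix i j assume ij: "i \<in> {0..<d}" "j \<in> {0..<d}"
      "(x i + (int (steps i) + 1) * a) mod int n = (x j + (int (steps j) + 1) * a) mod int n"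
    have "(x k + int (steps k) * a) mod int n = ((x k + (int (steps k) + 1) * a) mod int n - a) mod int n"
      for k by (simp add: mod_simps algebra_simps)
    with ij segment_inj[of i j "steps i" "steps j"] show "i = j" by simp
  qed
  then show "card ((\<lambda>j. (x j + (int (steps j) + 1) * a) mod int n) ` {0..<d}) = card (x ` {0..<d})"
    by (simp add: card_image x_inj)
qed (use steps_hit in auto)

end

subsection \<open>Lifts of reflexive paths\<close>

locale voltage_path =
  fixes n m :: nat and v :: "nat \<Rightarrow> 'v" and \<sigma> :: "'v arc \<Rightarrow> int"
  assumes n_pos: "1 \<le> n" and m_ge: "2 \<le> m" and v_inj: "inj_on v {1..m}"
    and voltage: "voltage_assignment n (reflexive_path m v) \<sigma>"
begin

abbreviation "\<Gamma> \<equiv> reflexive_path m v"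
abbreviation "loop t \<equiv> \<sigma> (Primary_Loop (v t))"
abbreviation "link t \<equiv> \<sigma> (Arc (v t) (v (Suc t)))"

lemma v_eq_iff: "t \<in> {1..m} \<Longrightarrow> t' \<in> {1..m} \<Longrightarrow> v t = v t' \<longleftrightarrow> t = t'"
  using v_inj by (auto dest: inj_onD)

lemma loop_arc: "t \<in> {1..m} \<Longrightarrow> Primary_Loop (v t) \<in> arcs_of \<Gamma>"
  by (auto simp: arcs_of_def reflexive_path_def)

lemma link_arc:
  assumes "t \<in> {1..<m}" shows "Arc (v t) (v (Suc t)) \<in> arcs_of \<Gamma>"
  using assms v_eq_iff[of t "Suc t"] by (auto simp: arcs_of_def reflexive_path_def)

lemma lift_edgeI:
  assumes "e \<in> arcs_of \<Gamma>" "z \<in> {0..<int n}"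
  shows "{(arc_tail e, z), (arc_head e, (z + \<sigma> e) mod int n)} \<in> edges (lift n \<Gamma> \<sigma>)"
proof -
  have "\<sigma> e \<in> {0..<int n}" using voltage assms by (auto simp: voltage_assignment_def)
  then have "\<sigma> e = ((z + \<sigma> e) mod int n - z) mod int n" by (simp add: mod_diff_left_eq)
  moreover have "(z + \<sigma> e) mod int n \<in> {0..<int n}" using n_pos by simp
  ultimately show ?thesis using assms unfolding lift_def by fastforce
qed

lemma loop_edge:
  "t \<in> {1..m} \<Longrightarrow> z \<in> {0..<int n} \<Longrightarrow> {(v t, z), (v t, (z + loop t) mod int n)} \<in> edges (lift n \<Gamma> \<sigma>)"
  using lift_edgeI[OF loop_arc] by fastforce

lemma link_edge:
  "t \<in> {1..<m} \<Longrightarrow> z \<in> {0..<int n} \<Longrightarrow>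
    {(v t, z), (v (Suc t), (z + link t) mod int n)} \<in> edges (lift n \<Gamma> \<sigma>)"
  using lift_edgeI[OF link_arc] by fastforce

text \<open>The base point \<open>c\<close> is free, so the fiber cycle can be numbered from
  whichever vertex the paths start or arrive at.\<close>

lemma edges_fiber:
  assumes t: "t \<in> {1..m}" and co: "coprime (loop t) (int n)"
  shows "edges (fiber n \<Gamma> \<sigma> (v t)) =
    (\<lambda>i. {(v t, (c + int i * loop t) mod int n), (v t, (c + int (Suc i) * loop t) mod int n)}) ` {..<n}"
    (is "_ = ?f ` _")
proof -
  have next_pos: "(c + int (Suc i) * loop t) mod int n = ((c + int i * loop t) mod int n + loop t) mod int n"
    for i by (simp add: mod_simps algebra_simps)
  have rot: "{(v t, z), (v t, (z + loop t) mod int n)} \<in> ?f ` {..<n}" if "z \<in> {0..<int n}" for z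
  proof -
    have "z \<in> (\<lambda>i. (c + int i * loop t) mod int n) ` {..<n}"
      using progression_mod_image[OF co] that by simp
    then show ?thesis unfolding next_pos by blast
  qed
  show ?thesis
  proof (intro equalityI subsetI)
    fix e assume "e \<in> edges (fiber n \<Gamma> \<sigma> (v t))"
    then obtain y z f where e: "e = {(v t, y), (v t, z)}" "y \<in> {0..<int n}" "z \<in> {0..<int n}"
      and f: "f \<in> arcs_of \<Gamma>" "arc_tail f = v t" "arc_head f = v t" "\<sigma> f = (z - y) mod int n"
      by (auto simp: fiber_def induced_subgraph_def lift_def)
    have loop: "loop t \<in> {0..<int n}" using voltage loop_arc[OF t] by (auto simp: voltage_assignment_def)
    consider "f = Primary_Loop (v t)" | "f = Secondary_Loop (v t)"
      using f by (cases f) (auto simp: arcs_of_def)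
    then show "e \<in> ?f ` {..<n}"
    proof cases
      case 1
      then have "(y + loop t) mod int n = z" using f e by (simp add: mod_simps)
      with rot[of y] e show ?thesis by simp
    next
      case 2
      \<comment> \<open>The secondary loop yields the same edges, read backwards.\<close>
      then have "(- loop t) mod int n = (z - y) mod int n"
        using f voltage loop_arc[OF t] by (auto simp: voltage_assignment_def)
      then have "int n dvd (- loop t) - (z - y)" by (simp only: mod_eq_dvd_iff)
      then have "int n dvd y - (z + loop t)" by (simp add: algebra_simps)
      then have "y mod int n = (z + loop t) mod int n" by (simp only: mod_eq_dvd_iff)
      then have "(z + loop t) mod int n = y" using e by simp
      with rot[of z] e show ?thesis by (simp add: insert_commute)
    qed
  next
    fix e assume "e \<in> ?f ` {..<n}"
    then obtain i where e: "e = ?f i" by blast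
    have "e \<in> edges (lift n \<Gamma> \<sigma>)"
      unfolding e next_pos using n_pos by (intro loop_edge t) simp
    moreover have "e \<subseteq> {v t} \<times> {0..<int n}" using n_pos by (auto simp: e)
    ultimately show "e \<in> edges (fiber n \<Gamma> \<sigma> (v t))"
      by (simp add: fiber_def induced_subgraph_def)
  qed
qed

text \<open>The last claim excludes \<open>n = 2\<close> because \<open>g 0\<close> and
  \<open>g 1\<close> are then the same edge, which is both deleted and kept.\<close>

lemma alternate_fiber_edges:
  fixes c :: int and d :: nat
  assumes t: "t \<in> {1..m}" and co: "coprime (loop t) (int n)"
    and d: "even d" "2 \<le> d" "d \<le> n"
  defines "f \<equiv> \<lambda>i. (v t, (c + int i * loop t) mod int n)"
  defines "g \<equiv> \<lambda>i. {f i, f (Suc i)}"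
  defines "E \<equiv> g ` {i. i < d \<and> even i}"
  shows "E \<subseteq> edges (fiber n \<Gamma> \<sigma> (v t))"
    and "card E = d div 2"
    and "alternating_consecutive n \<Gamma> \<sigma> (v t) E"
    and "edges (fiber n \<Gamma> \<sigma> (v t)) - E \<subseteq> g ` {i. i < n \<and> (odd i \<or> d \<le> i)}"
    and "n \<noteq> 2 \<Longrightarrow> g ` {i. i < n \<and> (odd i \<or> d \<le> i)} \<inter> E = {}"
proof -
  have edges: "edges (fiber n \<Gamma> \<sigma> (v t)) = g ` {..<n}"
    unfolding g_def f_def by (rule edges_fiber[OF t co])
  have f_inj: "inj_on f {..<n}"
    using inj_on_progression_mod[OF co, of c] by (auto simp: f_def inj_on_def)
  have f_iff: "f i = f j \<longleftrightarrow> i = j" if "i < n" "j < n" for i j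
    using f_inj that by (auto dest: inj_onD)
  have g_iff: "g i = g j \<longleftrightarrow> i = j" if "Suc i < n" "Suc j < n" for i j
    using that by (auto simp: g_def doubleton_eq_iff f_iff)
  \<comment> \<open>An even index below the even \<open>d\<close> is at most \<open>d - 2\<close>,
    so no edge of \<open>E\<close> wraps around the cycle.\<close>
  have E_subset: "{i. i < d \<and> even i} \<subseteq> {..<d - 1}"
    using d by auto (metis Suc_pred even_Suc less_SucE not_less_zero gr0I)
  show sub: "E \<subseteq> edges (fiber n \<Gamma> \<sigma> (v t))"
    unfolding E_def edges using d by auto
  have "inj_on g {..<d - 1}"
    using d by (intro inj_onI) (simp add: g_iff)
  then have "card E = card {i. i < d \<and> even i}"
    unfolding E_def using E_subset by (intro card_image) (rule inj_on_subset)
  also have "{i. i < d \<and> even i} = (*) 2 ` {..<d div 2}"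
    using d by (auto elim!: evenE)
  also have "card \<dots> = d div 2"
    by (simp add: card_image inj_on_def)
  finally show "card E = d div 2" .
  show "edges (fiber n \<Gamma> \<sigma> (v t)) - E \<subseteq> g ` {i. i < n \<and> (odd i \<or> d \<le> i)}"
    unfolding edges E_def by force
  show "g ` {i. i < n \<and> (odd i \<or> d \<le> i)} \<inter> E = {}" if "n \<noteq> 2"
  proof -
    \<comment> \<open>Replaces position \<open>n\<close> by 0, so that injectivity of
      \<open>f\<close> below \<open>n\<close> applies to every edge of the cycle.\<close>
    define next_index where "next_index i = (if Suc i = n then 0 else Suc i)" for i
    have f_next: "f (Suc i) = f (next_index i)" for i
    proof (cases "Suc i = n")
      case True
      have "f n = f 0" by (simp add: f_def)
      with True show ?thesis by (simp add: next_index_def)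
    qed (simp add: next_index_def)
    have "i = j" if ij: "i < n" "j < n" "g i = g j" for i j
    proof -
      have "next_index i < n" "next_index j < n"
        using ij n_pos by (auto simp: next_index_def)
      \<comment> \<open>Two equal edges with different indices would make each index the successor
        of the other, possible only on a cycle of two vertices.\<close>
      with ij have "i = j \<or> i = next_index j \<and> next_index i = j"
        by (auto simp: g_def f_next doubleton_eq_iff f_iff)
      then show ?thesis
        using ij \<open>n \<noteq> 2\<close> d(2,3) by (auto simp: next_index_def split: if_splits)
    qed
    then have "inj_on g {..<n}" by (intro inj_onI) simp
    then have "g ` {i. i < n \<and> (odd i \<or> d \<le> i)} \<inter> E =
        g ` ({i. i < n \<and> (odd i \<or> d \<le> i)} \<inter> {i. i < d \<and> even i})"
      unfolding E_def using d by (intro inj_on_image_Int[symmetric]) auto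
    also have "{i. i < n \<and> (odd i \<or> d \<le> i)} \<inter> {i. i < d \<and> even i} = {}" by auto
    finally show ?thesis by simp
  qed
  define p where "p = map f [0..<d]"
  have p_edges: "path_edges p = g ` {0..<d - 1}"
    unfolding p_def path_edges_map_upt g_def ..
  have E_iff: "g i \<in> E \<longleftrightarrow> even i" if "i < d - 1" for i
  proof
    assume "g i \<in> E"
    then obtain j where "j < d - 1" "even j" "g i = g j" unfolding E_def using E_subset by blast
    with that d show "even i" by (simp add: g_iff)
  qed (use that in \<open>auto simp: E_def\<close>)
  have "is_path (fiber n \<Gamma> \<sigma> (v t)) p"
    unfolding is_path_def
  proof (intro conjI)
    show "p \<noteq> []" using d by (simp add: p_def)
    have "inj_on f {0..<d}" by (rule inj_on_subset[OF f_inj]) (use d in auto)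
    then show "distinct p" by (simp add: p_def distinct_map)
    show "set p \<subseteq> verts (fiber n \<Gamma> \<sigma> (v t))"
      using t n_pos by (auto simp: p_def f_def fiber_def induced_subgraph_def lift_def reflexive_path_def)
    show "path_edges p \<subseteq> edges (fiber n \<Gamma> \<sigma> (v t))"
      unfolding p_edges edges using d by auto
  qed
  \<comment> \<open>Membership in \<open>E\<close> serves as the coloring; adjacent edges of the
    path have consecutive indices.\<close>
  moreover have "proper_edge_coloring (path_edges p) (\<lambda>e. e \<in> E)"
    unfolding proper_edge_coloring_def p_edges
  proof clarsimp
    fix i j assume ij: "i < d - Suc 0" "j < d - Suc 0" "g i \<noteq> g j" "g i \<inter> g j \<noteq> {}"
    then have "i \<noteq> j" "Suc i < n" "Suc j < n" using d by auto
    with ij have "i = Suc j \<or> j = Suc i" by (auto simp: g_def f_iff split: if_splits)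
    with ij show "(g i \<in> E) = (g j \<notin> E)" by (auto simp: E_iff)
  qed
  moreover have "E = {e \<in> path_edges p. (e \<in> E) = True}"
    using E_subset unfolding p_edges E_def by auto
  \<comment> \<open>A voltage of 0 would be coprime to \<open>n\<close> only for
    \<open>n = 1\<close>, but \<open>2 \<le> d \<le> n\<close>.\<close>
  moreover have "loop t \<noteq> 0"
    using co d by auto
  moreover have "{v t} \<in> edges \<Gamma>" using t by (auto simp: reflexive_path_def)
  ultimately show "alternating_consecutive n \<Gamma> \<sigma> (v t) E"
    unfolding alternating_consecutive_def using sub by blast
qed

end

subsection \<open>The billiard paths\<close>

locale billiard_path = voltage_path n m v \<sigma>
  for n m :: nat and v :: "nat \<Rightarrow> 'v" and \<sigma> :: "'v arc \<Rightarrow> int" +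
  fixes d :: nat and r l :: int
  assumes d_le: "d \<le> n" and co: "coprime r (int n)"
    and gcd_le: "t \<in> {2..m - 1} \<Longrightarrow> gcd (int n) (loop t) \<le> int d"
begin

abbreviation "P \<equiv> billiard_rounds n v \<sigma> d r l"

definition x :: "nat \<Rightarrow> nat \<Rightarrow> int" where
  "x t j = snd (last (P t j))"

text \<open>After \<open>t\<close> rounds the paths stand over \<open>v (Suc t)\<close>, so round
  \<open>Suc t\<close> uses \<open>loop (Suc t)\<close>. The case \<open>t = 0\<close> is the first
  fiber, which is left at once.\<close>

definition steps :: "nat \<Rightarrow> nat \<Rightarrow> nat" where
  "steps t j = (if t = 0 then 0
     else (LEAST s. (x t j + (int s + 1) * loop (Suc t)) mod int n \<in> x t ` {0..<d}))"

text \<open>Index 0 is the arrival point, already the last vertex of \<open>P t j\<close>; the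
  indices up to \<open>steps t j\<close> describe the whole visit to the fiber.\<close>

definition segment :: "nat \<Rightarrow> nat \<Rightarrow> nat \<Rightarrow> 'v \<times> int" where
  "segment t j i = (v (Suc t), (x t j + int i * loop (Suc t)) mod int n)"

definition \<beta> :: "nat \<Rightarrow> int" where
  "\<beta> t = l + (\<Sum>i = 1..t. link i) - (\<Sum>i = 2..t. loop i)"

lemma x_0: "x 0 j = (l + int j * r) mod int n"
  by (simp add: x_def)

lemma P_Suc:
  "P (Suc t) j = P t j @ map (segment t j) [1..<Suc (steps t j)] @ [(v (Suc (Suc t)), x (Suc t) j)]"
  by (simp add: billiard_step_def Let_def x_def steps_def segment_def[abs_def] del: upt_Suc)

lemma x_Suc:
  "x (Suc t) j = (x t j + int (steps t j) * loop (Suc t) + link (Suc t)) mod int n"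
  by (simp add: x_def billiard_step_def Let_def steps_def mod_simps)

lemma P_ne: "P t j \<noteq> []"
  by (cases t) (simp_all add: P_Suc del: billiard_rounds.simps(2))

lemma hd_P: "hd (P t j) = (v 1, (l + int j * r) mod int n)"
  by (induction t) (simp_all add: P_Suc P_ne del: billiard_rounds.simps(2))

lemma last_P: "last (P t j) = (v (Suc t), x t j)"
  by (cases t) (simp_all add: P_Suc x_0 del: billiard_rounds.simps(2))

lemma x_range: "x t j \<in> {0..<int n}"
  using n_pos by (cases t) (simp_all add: x_0 x_Suc)

lemma segment_0: "segment t j 0 = last (P t j)"
  using x_range[of t j] by (simp add: segment_def last_P)

lemma orbit_segments:
  "inj_on (x t) {0..<d} \<Longrightarrow> orbit_segments n d (x t)"
  using n_pos x_range by unfold_locales auto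

lemma steps_eq:
  assumes "inj_on (x t) {0..<d}" "t \<noteq> 0"
  shows "orbit_segments.steps n d (loop (Suc t)) (x t) = steps t"
  using assms by (simp add: fun_eq_iff orbit_segments.steps_def[OF orbit_segments] steps_def)

text \<open>Injectivity of the arrivals is an explicit premise because the induction that proves it
  uses this lemma.\<close>

lemma segment_inj_aux:
  assumes "inj_on (x t) {0..<d}"
    "i < d" "j < d" "p \<le> steps t i" "q \<le> steps t j" "segment t i p = segment t j q"
  shows "i = j \<and> p = q"
proof (cases "t = 0")
  case True
  with assms have "p = 0" "q = 0" by (simp_all add: steps_def)
  with assms x_range show ?thesis by (auto simp: segment_def dest: inj_onD)
next
  case False
  show ?thesis
    using orbit_segments.segment_inj[OF orbit_segments[OF assms(1)], of i j p "loop (Suc t)" q] assms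
    by (simp add: steps_eq[OF assms(1) False] segment_def)
qed

text \<open>Both claims share one induction: the permutation of starts, which controls the image,
  requires the arrivals of the previous round to be distinct.\<close>

lemma x_image_inj:
  "x t ` {0..<d} = (\<lambda>k. (\<beta> t + int k * r) mod int n) ` {0..<d} \<and> inj_on (x t) {0..<d}"
proof (induction t)
  case 0
  have "inj_on (x 0) {..<n}" unfolding x_0 by (rule inj_on_progression_mod[OF co])
  then have "inj_on (x 0) {0..<d}" by (rule inj_on_subset) (use d_le in auto)
  moreover have "x 0 ` {0..<d} = (\<lambda>k. (\<beta> 0 + int k * r) mod int n) ` {0..<d}"
    by (simp add: x_0 \<beta>_def)
  ultimately show ?case by blast
next
  case (Suc t)
  then have inj: "inj_on (x t) {0..<d}" by simp
  have "inj_on (\<lambda>j. snd (segment t j (steps t j))) {0..<d}"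
    by (intro inj_onI) (use segment_inj_aux[OF inj] in \<open>force simp: segment_def\<close>)
  then have "inj_on ((\<lambda>z. (z + link (Suc t)) mod int n) \<circ> (\<lambda>j. snd (segment t j (steps t j)))) {0..<d}"
    by (rule comp_inj_on) (rule inj_on_subset[OF inj_on_add_mod], use n_pos in \<open>auto simp: segment_def\<close>)
  then have "inj_on (x (Suc t)) {0..<d}"
    by (rule inj_on_cong[THEN iffD1, rotated]) (simp add: x_Suc segment_def mod_simps)
  moreover have "x (Suc t) ` {0..<d} = (\<lambda>k. (\<beta> (Suc t) + int k * r) mod int n) ` {0..<d}"
  proof (cases "t = 0")
    case True
    then show ?thesis
      by (intro image_cong) (simp_all add: x_Suc steps_def x_0 \<beta>_def mod_simps algebra_simps)
  next
    case False
    \<comment> \<open>A departure point is the next start minus one loop step. The next starts only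
      permute the arrivals, so the whole set is translated.\<close>
    have "x (Suc t) ` {0..<d} = (\<lambda>z. (z - loop (Suc t) + link (Suc t)) mod int n) `
        ((\<lambda>j. (x t j + (int (steps t j) + 1) * loop (Suc t)) mod int n) ` {0..<d})"
      unfolding image_image
    proof (intro image_cong refl)
      fix j
      have "((x t j + (int (steps t j) + 1) * loop (Suc t)) mod int n - loop (Suc t) + link (Suc t)) mod int n
         = ((x t j + (int (steps t j) + 1) * loop (Suc t)) - loop (Suc t) + link (Suc t)) mod int n"
        by (metis mod_add_left_eq mod_diff_left_eq)
      then show "x (Suc t) j =
         ((x t j + (int (steps t j) + 1) * loop (Suc t)) mod int n - loop (Suc t) + link (Suc t)) mod int n"
        by (simp add: x_Suc algebra_simps)
    qed
    also have "(\<lambda>j. (x t j + (int (steps t j) + 1) * loop (Suc t)) mod int n) ` {0..<d} = x t ` {0..<d}"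
      using orbit_segments.segment_ends[OF orbit_segments[OF inj], of "loop (Suc t)"]
      by (simp add: steps_eq[OF inj False])
    also have "x t ` {0..<d} = (\<lambda>k. (\<beta> t + int k * r) mod int n) ` {0..<d}"
      using Suc by simp
    also have "(\<lambda>z. (z - loop (Suc t) + link (Suc t)) mod int n) ` \<dots> =
       (\<lambda>k. (\<beta> (Suc t) + int k * r) mod int n) ` {0..<d}"
      unfolding image_image
    proof (intro image_cong refl)
      fix k
      have "((\<beta> t + int k * r) mod int n - loop (Suc t) + link (Suc t)) mod int n =
          (\<beta> t + int k * r - loop (Suc t) + link (Suc t)) mod int n"
        by (metis mod_add_left_eq mod_diff_left_eq)
      then show "((\<beta> t + int k * r) mod int n - loop (Suc t) + link (Suc t)) mod int n =
          (\<beta> (Suc t) + int k * r) mod int n"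
        using False by (simp add: \<beta>_def algebra_simps)
    qed
    finally show ?thesis .
  qed
  ultimately show ?case by blast
qed

lemma x_image: "x t ` {0..<d} = (\<lambda>k. (\<beta> t + int k * r) mod int n) ` {0..<d}"
  and x_inj: "inj_on (x t) {0..<d}"
  using x_image_inj by blast+

lemmas segment_inj = segment_inj_aux[OF x_inj]

text \<open>The bound on the gcd puts an arrival into every coset of the loop voltage, and segments
  exhaust each coset they meet.\<close>

lemma segment_cover:
  assumes "t \<noteq> 0" "Suc t < m" "z \<in> {0..<int n}"
  shows "\<exists>j<d. \<exists>q\<le>steps t j. segment t j q = (v (Suc t), z)"
proof -
  have "gcd (int n) (loop (Suc t)) \<le> int d" using assms by (intro gcd_le) auto
  from progression_reaches_coset[OF n_pos co this, of "\<beta> t" z] assms obtain k q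
    where kq: "k < d" "(\<beta> t + int k * r + int q * loop (Suc t)) mod int n = z" by auto
  have "(\<beta> t + int k * r) mod int n \<in> x t ` {0..<d}"
    unfolding x_image using kq by auto
  then obtain j where j: "j < d" "x t j = (\<beta> t + int k * r) mod int n" by auto
  have "(x t j + int q * loop (Suc t)) mod int n = z"
    using kq j by (simp add: mod_simps)
  from orbit_segments.segment_cover[OF orbit_segments[OF x_inj] j(1) this]
  show ?thesis by (simp add: steps_eq[OF x_inj assms(1)] segment_def)
qed

section \<open>Vertices of the billiard paths: covering and disjointness\<close>

lemma set_P_Suc:
  "set (P (Suc t) j) = set (P t j) \<union> segment t j ` {1..steps t j} \<union> {(v (Suc (Suc t)), x (Suc t) j)}"
  unfolding P_Suc by auto

lemma Union_set_P:
  assumes "t < m"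
  shows "(\<Union>j<d. set (P t j)) = {v 1} \<times> x 0 ` {0..<d} \<union> v ` {2..t} \<times> {0..<int n}
    \<union> {v (Suc t)} \<times> x t ` {0..<d}"
  using assms
proof (induction t)
  case 0
  then show ?case by (auto simp: x_0)
next
  case (Suc t)
  \<comment> \<open>The arrivals contribute index 0 of each segment, the new round the indices from
    1; together they fill an inner fiber. For \<open>t = 0\<close> nothing is added.\<close>
  have seg: "{v (Suc t)} \<times> x t ` {0..<d} \<union> (\<Union>j<d. segment t j ` {1..steps t j}) =
     (if t = 0 then {v (Suc t)} \<times> x t ` {0..<d} else {v (Suc t)} \<times> {0..<int n})" (is "?L = ?R")
  proof (cases "t = 0")
    case False
    have upper: "?L \<subseteq> {v (Suc t)} \<times> {0..<int n}"
      using x_range n_pos by (auto simp: segment_def)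
    have "(v (Suc t), z) \<in> ?L" if z: "z \<in> {0..<int n}" for z
    proof -
      from segment_cover[OF False Suc.prems z] obtain j q
        where "j < d" "q \<le> steps t j" "segment t j q = (v (Suc t), z)" by blast
      then show ?thesis
      proof (cases "q = 0")
        case True
        then show ?thesis
          using \<open>j < d\<close> \<open>segment t j q = _\<close> by (auto simp: segment_0 last_P)
      next
        case False
        then have "(v (Suc t), z) \<in> segment t j ` {1..steps t j}"
          using \<open>q \<le> _\<close> \<open>segment t j q = _\<close> 
          by (intro image_eqI[of _ _ q]) auto
        then show ?thesis using \<open>j < d\<close> by blast
      qed
    qed
    then have "w \<in> ?L" if "w \<in> {v (Suc t)} \<times> {0..<int n}" for w
      using that by (elim SigmaE) (simp only: singleton_iff)
    then have "?L = {v (Suc t)} \<times> {0..<int n}"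
      by (intro equalityI[OF upper] subsetI)
    then show ?thesis using False by simp
  qed (simp add: steps_def)
  have "(\<Union>j<d. set (P (Suc t) j)) = (\<Union>j<d. set (P t j)) \<union> (\<Union>j<d. segment t j ` {1..steps t j})
      \<union> {v (Suc (Suc t))} \<times> x (Suc t) ` {0..<d}"
    unfolding set_P_Suc by auto
  also have "\<dots> = {v 1} \<times> x 0 ` {0..<d} \<union> v ` {2..t} \<times> {0..<int n}
     \<union> ({v (Suc t)} \<times> x t ` {0..<d} \<union> (\<Union>j<d. segment t j ` {1..steps t j}))
      \<union> {v (Suc (Suc t))} \<times> x (Suc t) ` {0..<d}"
    using Suc by (simp add: Un_ac)
  also have "\<dots> = {v 1} \<times> x 0 ` {0..<d} \<union> v ` {2..Suc t} \<times> {0..<int n}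
      \<union> {v (Suc (Suc t))} \<times> x (Suc t) ` {0..<d}"
  proof (cases "t = 0")
    case False
    then have "v ` {2..Suc t} = insert (v (Suc t)) (v ` {2..t})" by (simp add: atLeastAtMostSuc_conv)
    with False show ?thesis unfolding seg by auto
  qed (simp add: steps_def)
  finally show ?case .
qed

lemma set_P_fst: "w \<in> set (P t j) \<Longrightarrow> fst w \<in> v ` {1..Suc t}"
proof (induction t)
  case (Suc t)
  then show ?case unfolding set_P_Suc by (force simp: segment_def)
qed simp

lemma set_P_last_fiber:
  assumes "t < m" "j < d" "(v (Suc t), z) \<in> set (P t j)"
  shows "z \<in> x t ` {0..<d}"
proof -
  have "(v (Suc t), z) \<in> (\<Union>j<d. set (P t j))" using assms by blast
  moreover have "v (Suc t) \<notin> v ` {2..t}" using assms by (auto simp: v_eq_iff)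
  moreover have "v (Suc t) = v 1 \<Longrightarrow> t = 0" using assms by (simp add: v_eq_iff)
  ultimately show ?thesis unfolding Union_set_P[OF assms(1)] by auto
qed

lemma segment_notin_P:
  assumes "t < m" "i < d" "j < d" "q \<in> {1..steps t j}"
  shows "segment t j q \<notin> set (P t i)"
proof
  assume "segment t j q \<in> set (P t i)"
  then have "snd (segment t j q) \<in> x t ` {0..<d}"
    using set_P_last_fiber[OF assms(1,2)] by (simp add: segment_def)
  \<comment> \<open>Over the current fiber, old vertices are arrivals only, that is, index 0 of some
    segment, whereas \<open>q\<close> is positive.\<close>
  then obtain k where "k < d" "segment t j q = segment t k 0"
    by (auto simp: segment_0 last_P) (auto simp: segment_def)
  with segment_inj[of j k q t 0] assms show False by simp
qed

lemma head_notin_P: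
  assumes "Suc t < m" shows "(v (Suc (Suc t)), z) \<notin> set (P t j)"
proof
  assume "(v (Suc (Suc t)), z) \<in> set (P t j)"
  then have "v (Suc (Suc t)) \<in> v ` {1..Suc t}" using set_P_fst by fastforce
  then show False using assms by (auto simp: v_eq_iff)
qed

lemma segment_ne_head:
  "Suc t < m \<Longrightarrow> segment t j q \<noteq> (v (Suc (Suc t)), z)"
  by (simp add: segment_def v_eq_iff)

lemma distinct_P: "t < m \<Longrightarrow> j < d \<Longrightarrow> distinct (P t j)"
proof (induction t)
  case (Suc t)
  then have t: "t < m" by simp
  have "inj_on (segment t j) (set [1..<Suc (steps t j)])"
  proof (rule inj_onI)
    fix p q assume "p \<in> set [1..<Suc (steps t j)]" "q \<in> set [1..<Suc (steps t j)]"
      and "segment t j p = segment t j q"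
    then show "p = q" using segment_inj[of j j p t q] Suc.prems by auto
  qed
  then show ?case
    unfolding P_Suc
    using Suc segment_notin_P[OF t] head_notin_P[of t] segment_ne_head[of t, symmetric]
    by (auto simp: distinct_map simp del: upt_Suc)
qed simp

lemma disjoint_P:
  "t < m \<Longrightarrow> i < d \<Longrightarrow> j < d \<Longrightarrow> i \<noteq> j \<Longrightarrow> set (P t i) \<inter> set (P t j) = {}"
proof (induction t)
  case 0
  then show ?case using x_inj[of 0] by (auto simp: x_0 inj_on_def)
next
  case (Suc t)
  then have t: "t < m" and IH: "set (P t i) \<inter> set (P t j) = {}" by simp_all
  have "segment t i p \<noteq> segment t j q" if "p \<in> {1..steps t i}" "q \<in> {1..steps t j}" for p q
    using segment_inj[of i j p t q] that Suc.prems by auto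
  moreover have "x (Suc t) i \<noteq> x (Suc t) j"
    using x_inj[of "Suc t"] Suc.prems by (auto dest: inj_onD)
  moreover have "segment t i p \<notin> set (P t j)" if "p \<in> {1..steps t i}" for p
    using segment_notin_P[OF t] that Suc.prems by blast
  moreover have "segment t j p \<notin> set (P t i)" if "p \<in> {1..steps t j}" for p
    using segment_notin_P[OF t] that Suc.prems by blast
  ultimately show ?case
    unfolding set_P_Suc using IH head_notin_P[OF Suc.prems(1)] segment_ne_head[OF Suc.prems(1)]
    by (auto simp: disjoint_iff) metis+
qed

section \<open>Edges of the billiard paths\<close>

lemma path_edges_P_Suc:
  "path_edges (P (Suc t) j) = path_edges (P t j)
    \<union> (\<lambda>i. {segment t j i, segment t j (Suc i)}) ` {0..<steps t j}
    \<union> {{segment t j (steps t j), (v (Suc (Suc t)), x (Suc t) j)}}"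
proof -
  define N where "N = map (segment t j) [1..<Suc (steps t j)] @ [(v (Suc (Suc t)), x (Suc t) j)]"
  \<comment> \<open>The last old vertex is shared: it also opens the new stretch as its point of
    index 0.\<close>
  have P: "butlast (P t j) @ [segment t j 0] = P t j"
    using P_ne segment_0 by simp
  then have "P (Suc t) j = butlast (P t j) @ segment t j 0 # N"
    unfolding P_Suc N_def by (metis append.assoc append_Cons append_Nil)
  then have "path_edges (P (Suc t) j) = path_edges (P t j) \<union> path_edges (segment t j 0 # N)"
    using P by (simp only: path_edges_append_overlap)
  also have "segment t j 0 # N = map (segment t j) [0..<Suc (steps t j)] @ [(v (Suc (Suc t)), x (Suc t) j)]"
    unfolding N_def by (simp add: upt_conv_Cons del: upt_Suc)
  also have "path_edges \<dots> = (\<lambda>i. {segment t j i, segment t j (Suc i)}) ` {0..<steps t j}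
    \<union> {{segment t j (steps t j), (v (Suc (Suc t)), x (Suc t) j)}}"
    by (subst path_edges_append) (simp_all add: path_edges_map_upt last_map del: upt_Suc)
  finally show ?thesis by blast
qed

lemma segment_range: "snd (segment t j i) \<in> {0..<int n}"
  using n_pos by (simp add: segment_def)

lemma path_edges_P_lift:
  "t < m \<Longrightarrow> path_edges (P t j) \<subseteq> edges (lift n \<Gamma> \<sigma>)"
proof (induction t)
  case (Suc t)
  have "{segment t j i, segment t j (Suc i)} \<in> edges (lift n \<Gamma> \<sigma>)" for i
    using loop_edge[of "Suc t" "snd (segment t j i)"] segment_range[of t j i] Suc.prems
    by (simp add: segment_def mod_simps algebra_simps)
  moreover have "{segment t j (steps t j), (v (Suc (Suc t)), x (Suc t) j)} \<in> edges (lift n \<Gamma> \<sigma>)"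
    using link_edge[of "Suc t" "snd (segment t j (steps t j))"] segment_range[of t j "steps t j"]
      Suc.prems
    by (simp add: segment_def mod_simps x_Suc algebra_simps)
  ultimately show ?case unfolding path_edges_P_Suc using Suc by auto
qed simp

text \<open>Serves to show that the paths avoid the deleted edges. No loop steps are made over
  \<open>v 1\<close>, and later rounds stay over other vertices apart from the link that leaves
  \<open>v 1\<close>.\<close>

lemma path_edges_P_first_fiber:
  "t < m \<Longrightarrow> e \<in> path_edges (P t j) \<Longrightarrow> \<not> e \<subseteq> {v 1} \<times> UNIV"
proof (induction t)
  case (Suc t)
  have "v (Suc (Suc t)) \<noteq> v 1" using Suc.prems by (simp add: v_eq_iff)
  moreover have "v (Suc t) \<noteq> v 1" if "steps t j \<noteq> 0"
    using that Suc.prems by (auto simp: v_eq_iff steps_def split: if_splits)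
  ultimately show ?case
    using Suc unfolding path_edges_P_Suc by (auto simp: segment_def)
qed simp

lemma path_edges_P_last_fiber:
  assumes "t < m" "e \<in> path_edges (P t j)" shows "\<not> e \<subseteq> {v (Suc t)} \<times> UNIV"
proof (cases t)
  case (Suc t')
  have "v (Suc t') \<noteq> v (Suc t)" using assms Suc by (simp add: v_eq_iff)
  \<comment> \<open>Nonemptiness matters: an empty edge would be contained in the fiber. The final
    link reaches the fiber with one end only.\<close>
  moreover have "e' \<inter> {v (Suc t)} \<times> UNIV = {} \<and> e' \<noteq> {}" if "e' \<in> path_edges (P t' j)" for e'
    using path_edges_subset_set[OF that] head_notin_P[of t' _ j] assms Suc that
    by (auto simp: path_edges_def)
  ultimately show ?thesis
    using assms unfolding Suc path_edges_P_Suc by (auto simp: segment_def)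
qed (use assms in simp)

end

section \<open>Change of the starting value\<close>

lemma add_mod_eq_iff:
  fixes c y z :: int
  assumes "y \<in> {0..<int n}" "z \<in> {0..<int n}"
  shows "(y + c) mod int n = (z + c) mod int n \<longleftrightarrow> y = z"
  using inj_on_add_mod[of c n] assms by (auto dest: inj_onD)

text \<open>Odd shifting is stated for starting value 0. Each round depends only on differences of
  positions, so it commutes with translation by \<open>l\<close>.\<close>

lemma billiard_rounds_translate:
  assumes "1 \<le> n"
  shows "last (billiard_rounds n v \<sigma> d r l t j) =
      (v (Suc t), (snd (last (billiard_rounds n v \<sigma> d r 0 t j)) + l) mod int n)"
proof (induction t arbitrary: j)
  case 0
  show ?case by (simp add: mod_simps algebra_simps)
next
  case (Suc t)
  define X where "X = (\<lambda>j. snd (last (billiard_rounds n v \<sigma> d r 0 t j)))"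
  define a where "a = \<sigma> (Primary_Loop (v (Suc t)))"
  have X_range: "X j \<in> {0..<int n}" for j
    unfolding X_def using assms by (cases t) (simp_all add: billiard_step_def Let_def)
  have X_l: "snd (last (billiard_rounds n v \<sigma> d r l t j)) = (X j + l) mod int n" for j
    using Suc by (simp add: X_def)
  \<comment> \<open>The stopping test agrees for both starting values, hence so do the two
    \<open>LEAST\<close> step counts.\<close>
  have "((X j + l) mod int n + q * a) mod int n \<in> (\<lambda>j. (X j + l) mod int n) ` {0..<d} \<longleftrightarrow>
      (X j + q * a) mod int n \<in> X ` {0..<d}" for q
  proof -
    have "((X j + l) mod int n + q * a) mod int n = ((X j + q * a) mod int n + l) mod int n"
      by (simp add: mod_simps algebra_simps)
    moreover have "((X j + q * a) mod int n + l) mod int n = (X i + l) mod int n \<longleftrightarrow>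
        (X j + q * a) mod int n = X i" for i
      using X_range[of i] assms by (intro add_mod_eq_iff) auto
    ultimately show ?thesis by (simp add: image_iff)
  qed
  then show ?case
    by (simp add: billiard_step_def Let_def X_l a_def[symmetric] X_def[symmetric])
      (simp add: mod_simps algebra_simps)
qed

subsection \<open>The Hamiltonian cycle\<close>

text \<open>Inverts the list of the shift condition: \<open>P j\<close> arrives at position
  \<open>(j + s) mod d\<close>.\<close>

lemma rotation_nth:
  assumes "j < d" "s < d"
  shows "([d - s..<d] @ [0..<d - s]) ! ((j + s) mod d) = j"
proof (cases "j + s < d")
  case False
  then have "(j + s) mod d = j + s - d" using assms by (simp add: mod_if)
  moreover have "j + s - d < s" using False assms by linarith
  ultimately show ?thesis using False assms by (simp add: nth_append)
qed (use assms in \<open>simp add: nth_append\<close>)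

lemma gcd_le_double_path_c:
  assumes "t \<in> {2..m - 1}"
  shows "gcd (int n) (\<sigma> (Primary_Loop (v t))) \<le> int (2 * path_c n m v \<sigma>)"
proof -
  define M where "M = Max ((\<lambda>t. gcd (int n) (\<sigma> (Primary_Loop (v t)))) ` {2..m - 1})"
  have "gcd (int n) (\<sigma> (Primary_Loop (v t))) \<le> M"
    unfolding M_def using assms by (intro Max_ge) auto
  moreover have "path_c n m v \<sigma> = nat \<lceil>real_of_int M / 2\<rceil>"
    using assms by (auto simp: path_c_def M_def)
  moreover have "real_of_int M / 2 \<le> real (nat \<lceil>real_of_int M / 2\<rceil>)"
    by linarith
  ultimately show ?thesis by linarith
qed

theorem theorem1:
  fixes n m d :: nat
    and v :: "nat \<Rightarrow> 'v"
    and \<sigma> :: "'v arc \<Rightarrow> int"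
    and r l :: int
    and \<Gamma> :: "'v ugraph"
    and P :: "nat \<Rightarrow> ('v \<times> int) list"
  assumes "n \<ge> 1" and "m \<ge> 2" and "inj_on v {1..m}"
    and "\<Gamma> = reflexive_path m v"
    and "voltage_assignment n \<Gamma> \<sigma>"
    and "odd_shifting n m v \<sigma> r"
    and "coprime r (int n)"
    and "l \<in> {0..<int n}"
    and "d = 2 * path_c n m v \<sigma>"
    and "P = billiard n m v \<sigma> d r l"
  shows "\<exists>C EL ER.
      hamiltonian_cycle (lift n \<Gamma> \<sigma>) C \<and>
      EL \<subseteq> edges (fiber n \<Gamma> \<sigma> (v 1)) \<and>
      ER \<subseteq> edges (fiber n \<Gamma> \<sigma> (v m)) \<and>
      (\<forall>j<d. path_edges (P j) \<subseteq> cycle_edges C) \<and>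
      card EL = d div 2 \<and> card ER = d div 2 \<and>
      EL = {{(v 1, (l + int (2 * i) * r) mod int n), (v 1, (l + int (2 * i + 1) * r) mod int n)}
             | i. i < d div 2} \<and>
      alternating_consecutive n \<Gamma> \<sigma> (v 1) EL \<and>
      alternating_consecutive n \<Gamma> \<sigma> (v m) ER \<and>
      edges (fiber n \<Gamma> \<sigma> (v 1)) - EL \<subseteq> cycle_edges C \<and>
      edges (fiber n \<Gamma> \<sigma> (v m)) - ER \<subseteq> cycle_edges C \<and>
      (n \<noteq> 2 \<longrightarrow> cycle_edges C \<inter> EL = {} \<and> cycle_edges C \<inter> ER = {})"
proof -
  define \<beta>0 where "\<beta>0 = (\<Sum>t = 1..m - 1. \<sigma> (Arc (v t) (v (Suc t))))
    - (\<Sum>t = 2..m - 1. \<sigma> (Primary_Loop (v t)))"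
  have loops: "\<sigma> (Primary_Loop (v 1)) = r" "\<sigma> (Primary_Loop (v m)) = r"
    using assms(6) by (simp_all add: odd_shifting_def)
  have d_le: "d \<le> n"
    using assms(6,7,9) by (auto simp: odd_shifting_def Let_def coprime_iff_gcd_eq_1)
  obtain s where s: "odd s" "0 < s" "s < d"
    and arrive0: "\<And>k. k < d \<Longrightarrow>
      last (billiard n m v \<sigma> d r 0 (([d - s..<d] @ [0..<d - s]) ! k)) = (v m, (\<beta>0 + int k * r) mod int n)"
    using assms(6,9) by (auto simp: odd_shifting_def Let_def \<beta>0_def)
  have d_even: "even d" and d_ge: "2 \<le> d" using assms(9) s by auto
  interpret B: billiard_path n m v \<sigma> d r l
    using assms(1-3,5,7) d_le gcd_le_double_path_c[of _ m n \<sigma> v]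
    by unfold_locales (simp_all add: assms(4,9))
  have P: "P = B.P (m - 1)" using assms by (simp add: billiard_def)
  have m: "Suc (m - 1) = m" "m - 1 < m" using assms by auto
  have v1m: "v 1 \<noteq> v m" using assms by (simp add: B.v_eq_iff)
  \<comment> \<open>Base point of the right fiber, chosen so that the arrivals occupy positions
    \<open>0, ..., d - 1\<close> of \<open>R\<close>.\<close>
  define c where "c = B.\<beta> (m - 1)"
  have c: "c = \<beta>0 + l" by (simp add: c_def B.\<beta>_def \<beta>0_def)
  define L where "L = (\<lambda>i. (v 1, (l + int i * r) mod int n))"
  define R where "R = (\<lambda>i. (v m, (c + int i * r) mod int n))"
  have arrive: "last (P j) = R ((j + s) mod d)" if j: "j < d" for j
  proof -
    have "last (billiard n m v \<sigma> d r 0 j) = (v m, (\<beta>0 + int ((j + s) mod d) * r) mod int n)"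
      using arrive0[of "(j + s) mod d"] rotation_nth[OF j s(3)] j by simp
    then show ?thesis
      using billiard_rounds_translate[OF assms(1), of v \<sigma> d r l "m - 1" j] m
      by (simp add: P billiard_def R_def c mod_simps algebra_simps)
  qed
  have L_inj: "inj_on L {..<n}" and R_inj: "inj_on R {..<n}"
    using inj_on_progression_mod[OF assms(7), of l] inj_on_progression_mod[OF assms(7), of c]
    by (auto simp: L_def R_def inj_on_def)
  have L_image: "L ` {..<n} = {v 1} \<times> {0..<int n}" and R_image: "R ` {..<n} = {v m} \<times> {0..<int n}"
    using progression_mod_image[OF assms(7), of l] progression_mod_image[OF assms(7), of c]
    unfolding L_def R_def by (auto simp: image_iff set_eq_iff)
  have Union_P: "(\<Union>j<d. set (P j)) = L ` {..<d} \<union> v ` {2..m - 1} \<times> {0..<int n} \<union> R ` {..<d}"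
  proof -
    have "{v 1} \<times> B.x 0 ` {0..<d} = L ` {..<d}"
      by (auto simp: L_def B.x_0 image_iff)
    moreover have "{v m} \<times> B.x (m - 1) ` {0..<d} = R ` {..<d}"
      unfolding B.x_image by (auto simp: R_def c_def)
    ultimately show ?thesis
      unfolding P B.Union_set_P[OF m(2)] m(1) by simp
  qed
  have split: "f ` {..<n} = f ` {..<d} \<union> f ` {d..<n}" for f :: "nat \<Rightarrow> 'v \<times> int"
    using d_le by (auto simp flip: image_Un simp: ivl_disj_un)
  have far: "f ` {..<d} \<inter> f ` {d..<n} = {}" if "inj_on f {..<n}" for f :: "nat \<Rightarrow> 'v \<times> int"
    using that d_le by (subst inj_on_image_Int[symmetric, of f "{..<n}"]) auto
  have inner: "(v ` {2..m - 1} \<times> {0..<int n}) \<inter> L ` {..<n} = {}"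
    "(v ` {2..m - 1} \<times> {0..<int n}) \<inter> R ` {..<n} = {}"
    "L ` {..<n} \<inter> R ` {..<n} = {}"
    unfolding L_image R_image using v1m assms(2) by (auto simp: B.v_eq_iff)
  interpret Z: zigzag L R P n d s
  proof unfold_locales
    show "L ` {..<n} \<inter> R ` {..<n} = {}" by (rule inner)
    fix j assume j: "j < d"
    have sub: "set (P j) \<subseteq> L ` {..<d} \<union> v ` {2..m - 1} \<times> {0..<int n} \<union> R ` {..<d}"
      unfolding Union_P[symmetric] using j by blast
    \<comment> \<open>Applied once per end: a path meets an end fiber only in its first
      \<open>d\<close> positions, and those are disjoint from the far ones.\<close>
    have avoid: "S \<inter> X2 = {}" if "S \<subseteq> X1 \<union> M \<union> Y1" "M \<inter> X = {}" "X \<inter> Y = {}"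
      "X = X1 \<union> X2" "Y = Y1 \<union> Y2" "X1 \<inter> X2 = {}" for S X X1 X2 M Y Y1 Y2 :: "('v \<times> int) set"
      using that by blast
    show "set (P j) \<inter> L ` {d..<n} = {}"
      by (rule avoid[OF sub inner(1,3) split split far[OF L_inj]])
    have "set (P j) \<subseteq> R ` {..<d} \<union> v ` {2..m - 1} \<times> {0..<int n} \<union> L ` {..<d}"
      using sub by (simp add: Un_ac)
    then show "set (P j) \<inter> R ` {d..<n} = {}"
      by (rule avoid[OF _ inner(2) inner(3)[unfolded Int_commute[of "L ` _"]] split split far[OF R_inj]])
    show "hd (P j) = L j" "P j \<noteq> []" "distinct (P j)"
      using j m by (simp_all add: P B.hd_P B.P_ne B.distinct_P L_def)
  next
    show "L n = L 0" "R n = R 0" by (simp_all add: L_def R_def)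
    show "set (P i) \<inter> set (P j) = {}" if "i < d" "j < d" "i \<noteq> j" for i j
      unfolding P by (rule B.disjoint_P[OF m(2) that])
  qed (use d_even d_ge d_le s L_inj R_inj arrive in simp_all)
  let ?far = "{i. i < n \<and> (odd i \<or> d \<le> i)}"
  define EL where "EL = (\<lambda>i. {L i, L (Suc i)}) ` {i. i < d \<and> even i}"
  define ER where "ER = (\<lambda>i. {R i, R (Suc i)}) ` {i. i < d \<and> even i}"
  have L_eq: "(v 1, (l + int i * r) mod int n) = L i" and R_eq: "(v m, (c + int i * r) mod int n) = R i" for i
    by (simp_all add: L_def R_def)
  have "1 \<in> {1..m}" "m \<in> {1..m}" using assms(2) by auto
  \<comment> \<open>The base points \<open>l\<close> and \<open>c\<close> turn the generic
    progression of a fiber into \<open>L\<close> and \<open>R\<close>.\<close>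
  note left = B.alternate_fiber_edges[OF \<open>1 \<in> {1..m}\<close>, unfolded loops, OF assms(7) d_even d_ge d_le,
      of l, unfolded L_eq, folded EL_def assms(4)]
  note right = B.alternate_fiber_edges[OF \<open>m \<in> {1..m}\<close>, unfolded loops, OF assms(7) d_even d_ge d_le,
      of c, unfolded R_eq, folded ER_def assms(4)]
  have EL: "EL = {{(v 1, (l + int (2 * i) * r) mod int n), (v 1, (l + int (2 * i + 1) * r) mod int n)}
             | i. i < d div 2}"
  proof -
    have "{i. i < d \<and> even i} = (*) 2 ` {..<d div 2}"
      using d_even by (auto elim!: evenE)
    then have "EL = (\<lambda>i. {L (2 * i), L (2 * i + 1)}) ` {..<d div 2}"
      by (simp add: EL_def image_image)
    then show ?thesis unfolding L_def by blast
  qed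
  have verts: "set Z.C = verts (lift n \<Gamma> \<sigma>)"
  proof -
    have "{1..m} = insert 1 (insert m {2..m - 1})" using assms(2) by auto
    then have "verts (lift n \<Gamma> \<sigma>) = L ` {..<n} \<union> v ` {2..m - 1} \<times> {0..<int n} \<union> R ` {..<n}"
      unfolding L_image R_image assms(4) by (auto simp: lift_def reflexive_path_def)
    then show ?thesis
      unfolding Z.set_C Union_P split[of L] split[of R] by (simp only: Un_ac)
  qed
  have fiber_lift: "edges (fiber n \<Gamma> \<sigma> u) \<subseteq> edges (lift n \<Gamma> \<sigma>)" for u
    by (auto simp: fiber_def induced_subgraph_def)
  have L_edges: "edges (fiber n \<Gamma> \<sigma> (v 1)) = (\<lambda>i. {L i, L (Suc i)}) ` {..<n}"
    using B.edges_fiber[of 1 l] assms loops by (simp add: L_def)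
  have R_edges: "edges (fiber n \<Gamma> \<sigma> (v m)) = (\<lambda>i. {R i, R (Suc i)}) ` {..<n}"
    using B.edges_fiber[of m c] assms loops by (simp add: R_def)
  have ham: "hamiltonian_cycle (lift n \<Gamma> \<sigma>) Z.C"
    unfolding hamiltonian_cycle_def
  proof (intro conjI verts Z.distinct_C)
    have "length Z.C = card (verts (lift n \<Gamma> \<sigma>))"
      using distinct_card[OF Z.distinct_C] verts by simp
    also have "\<dots> = m * n"
      using assms(3) by (simp add: lift_def assms(4) reflexive_path_def card_cartesian_product card_image)
    finally show "3 \<le> length Z.C"
      using mult_le_mono[of 2 m 2 n] assms(2) d_ge d_le by simp
    have "(\<lambda>i. {L i, L (Suc i)}) ` ?far \<subseteq> edges (lift n \<Gamma> \<sigma>)"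
      "(\<lambda>i. {R i, R (Suc i)}) ` ?far \<subseteq> edges (lift n \<Gamma> \<sigma>)"
      using fiber_lift[of "v 1"] fiber_lift[of "v m"] unfolding L_edges R_edges by auto
    moreover have "path_edges (P j) \<subseteq> edges (lift n \<Gamma> \<sigma>)" for j
      unfolding P assms(4) by (rule B.path_edges_P_lift[OF m(2)])
    ultimately show "cycle_edges Z.C \<subseteq> edges (lift n \<Gamma> \<sigma>)"
      unfolding Z.cycle_edges_C by (intro Un_least UN_least)
  qed
  have EL_fiber: "e \<in> EL \<Longrightarrow> e \<subseteq> {v 1} \<times> UNIV" and ER_fiber: "e \<in> ER \<Longrightarrow> e \<subseteq> {v m} \<times> UNIV" for e
    by (auto simp: EL_def ER_def L_def R_def)
  \<comment> \<open>Every deleted edge lies inside an end fiber, while no path edge does.\<close>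
  have avoid_P: "path_edges (P j) \<inter> EL = {}" "path_edges (P j) \<inter> ER = {}" for j
    using B.path_edges_P_first_fiber[OF m(2), of _ j] B.path_edges_P_last_fiber[OF m(2), of _ j]
      EL_fiber ER_fiber
    unfolding P m(1) by blast+
  have avoid_LR: "(\<lambda>i. {L i, L (Suc i)}) ` ?far \<inter> ER = {}" "(\<lambda>i. {R i, R (Suc i)}) ` ?far \<inter> EL = {}"
    using v1m by (auto simp: L_def R_def EL_def ER_def doubleton_eq_iff)
  have "cycle_edges Z.C \<inter> EL = {} \<and> cycle_edges Z.C \<inter> ER = {}" if "n \<noteq> 2"
  proof -
    have "(\<Union>j<d. path_edges (P j)) \<inter> EL = {}" "(\<Union>j<d. path_edges (P j)) \<inter> ER = {}"
      using avoid_P by blast+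
    then show ?thesis
      using left(5)[OF that] right(5)[OF that] avoid_LR
      unfolding Z.cycle_edges_C Int_Un_distrib2 Un_empty by (intro conjI)
  qed
  moreover have "edges (fiber n \<Gamma> \<sigma> (v 1)) - EL \<subseteq> cycle_edges Z.C"
    using left(4) unfolding Z.cycle_edges_C by (simp only: le_supI1 le_supI2)
  moreover have "edges (fiber n \<Gamma> \<sigma> (v m)) - ER \<subseteq> cycle_edges Z.C"
    using right(4) unfolding Z.cycle_edges_C by (simp only: le_supI1 le_supI2)
  moreover have "\<forall>j<d. path_edges (P j) \<subseteq> cycle_edges Z.C"
    unfolding Z.cycle_edges_C by blast
  ultimately show ?thesis
    using ham left(1-3) right(1-3) EL
    by (intro exI[of _ Z.C] exI[of _ EL] exI[of _ ER]) simp
qed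

end
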